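(* Let $Z:\mathfrak{H}^0\to\mathbb{R}$ be a $\mathbb{Q}$-linear map such that $Z\bigl(\mu(\mathbf{k},\mathbf{l})\bigr)=Z\bigl(\mathbf{k}\circledast\mathbf{l}^\star\bigr)$ for all non-empty indices $\mathbf{k},\mathbf{l}$. Then $Z(\mathbf{k}\sqcup\!\sqcup\mathbf{l})=Z(\mathbf{k})Z(\mathbf{l})$ for all admissible indices $\mathbf{k},\mathbf{l}$ if and only if $Z(\mathbf{k}*\mathbf{l})=Z(\mathbf{k})Z(\mathbf{l})$ for all admissible indices $\mathbf{k},\mathbf{l}$.
   Context: Let $\mathfrak{H}=\mathbb{Q}\langle e_0,e_1\rangle$, $\mathfrak{H}^1=\mathbb{Q}+e_1\mathfrak{H}$, $\mathfrak{H}^0=\mathbb{Q}+e_1\mathfrak{H}e_0$, $e_k=e_1e_0^{k-1}$. Indices (finite possibly empty sequences $(k_1,\dots,k_r)$ of positive integers; admissible if empty or $k_r\ge2$) are identified with words $e_{k_1}\cdots e_{k_r}$ (empty $\leftrightarrow1$); maps are extended linearly. Shuffle $\sqcup\!\sqcup$: bilinear, $1\sqcup\!\sqcup w=w\sqcup\!\sqcup1=w$, $av\sqcup\!\sqcup bw=a(v\sqcup\!\sqcup bw)+b(av\sqcup\!\sqcup w)$ ($a,b\in\{e_0,e_1\}$). Harmonic $*$ on $\mathfrak{H}^1$: $1*w=w*1=w$, $e_kv*e_lw=e_k(v*e_lw)+e_l(e_kv*w)+e_{k+l}(v*w)$. $\circledast:e_1\mathfrak{H}\times e_1\mathfrak{H}\to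 e_1\mathfrak{H}e_0$ is bilinear with $ve_k\circledast we_l=(v*w)e_{k+l}$ ($v,w\in\mathfrak{H}^1$). For non-empty $\mathbf{l}=(l_1,\dots,l_s)$, $\mathbf{l}^\star$ is the sum of the $2^{s-1}$ indices $(l_1\bigcirc\cdots\bigcirc l_s)$, each $\bigcirc$ a comma or plus. A 2-poset is a finite poset with labels $\delta:X\to\{0,1\}$; $W(X)$ is the sum over all linear extensions $x_1,\dots,x_n$ of $e_{\delta(x_1)}\cdots e_{\delta(x_n)}$. For non-empty $\mathbf{k}=(k_1,\dots,k_r)$ of weight $K$ and non-empty $\mathbf{l}=(l_1,\dots,l_s)$, $\mu(\mathbf{k},\mathbf{l})=W(Q)$ where $Q$ has elements $a_1,\dots,a_K$ and $b_{j,i}$ ($1\le j\le s$, $1\le i\le l_j$), order generated by $a_1<\cdots<a_K<b_{s,1}$, $b_{j,1}<\cdots<b_{j,l_j}$, $b_{j-1,1}<b_{j,l_j}$ ($2\le j\le s$), and labels $\delta(a_t)=1$ iff $t\in\{1,k_1+1,\dots,k_1+\dots+k_{r-1}+1\}$ (else 0), $\delta(b_{s,1})=0$, $\delta(b_{j,1})=1$ for $j<s$, $\delta(b_{j,i})=0$ for $i\ge2$. *)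

theory Defs
  imports Complex_Main "HOL-Library.Poly_Mapping"
begin

text \<open>
  The free algebra \<open>\<rat>\<langle>e\<^sub>0, e\<^sub>1\<rangle>\<close> is the monoid algebra of the free monoid of words: with lists
  regarded as a monoid under concatenation, the product of \<open>_ \<Rightarrow>\<^sub>0 _\<close> from the library is the
  concatenation product and \<open>1\<close> is the empty word.
\<close>

instantiation list :: (type) monoid_add
begin

definition zero_list :: "'a list" where "zero_list = []"

definition plus_list :: "'a list \<Rightarrow> 'a list \<Rightarrow> 'a list" where "plus_list = (@)"

instance by standard (simp_all add: zero_list_def plus_list_def)

end

datatype letter = E0 | E1

type_synonym hoff = "letter list \<Rightarrow>\<^sub>0 rat"

definition word :: "letter list \<Rightarrow> hoff" where
  "word w = Poly_Mapping.single w 1"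

definition const :: "rat \<Rightarrow> hoff" where
  "const c = Poly_Mapping.single [] c"

definition e0 :: hoff where "e0 = word [E0]"

definition e1 :: hoff where "e1 = word [E1]"

definition H1 :: "hoff set" where
  "H1 = {const c + e1 * h | c h. True}"

definition H0 :: "hoff set" where
  "H0 = {const c + e1 * h * e0 | c h. True}"

text \<open>
  A map defined on a subspace is a total function of which only the values on that subspace matter.
\<close>

definition rat_linear_on :: "hoff set \<Rightarrow> (hoff \<Rightarrow> real) \<Rightarrow> bool" where
  "rat_linear_on V Z \<longleftrightarrow>
     (\<forall>x\<in>V. \<forall>y\<in>V. Z (x + y) = Z x + Z y) \<and>
     (\<forall>c. \<forall>x\<in>V. Z (const c * x) = of_rat c * Z x)"

definition bilinear_ext :: "(letter list \<Rightarrow> letter list \<Rightarrow> hoff) \<Rightarrow> hoff \<Rightarrow> hoff \<Rightarrow> hoff" where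
  "bilinear_ext f x y =
     (\<Sum>u\<in>Poly_Mapping.keys x. \<Sum>v\<in>Poly_Mapping.keys y. const (Poly_Mapping.lookup x u * Poly_Mapping.lookup y v) * f u v)"


definition is_index :: "nat list \<Rightarrow> bool" where
  "is_index k \<longleftrightarrow> (\<forall>i\<in>set k. 0 < i)"

definition admissible :: "nat list \<Rightarrow> bool" where
  "admissible k \<longleftrightarrow> is_index k \<and> (k = [] \<or> 2 \<le> last k)"

definition ek :: "nat \<Rightarrow> hoff" where
  "ek k = e1 * e0 ^ (k - 1)"

definition idx :: "nat list \<Rightarrow> hoff" where
  "idx k = prod_list (map ek k)"

definition index_word :: "nat list \<Rightarrow> letter list" where
  "index_word k = concat (map (\<lambda>i. E1 # replicate (i - 1) E0) k)"

text \<open>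
  The words lying in \<open>H1\<close> are exactly the words of indices; on all other words
  the following decoding function is a junk value.
\<close>

definition word_index :: "letter list \<Rightarrow> nat list" where
  "word_index = inv_into {k. is_index k} index_word"


fun shuffle_words :: "letter list \<Rightarrow> letter list \<Rightarrow> hoff" where
  "shuffle_words [] w = word w"
| "shuffle_words v [] = word v"
| "shuffle_words (a # v) (b # w) =
     word [a] * shuffle_words v (b # w) + word [b] * shuffle_words (a # v) w"

definition shuffle :: "hoff \<Rightarrow> hoff \<Rightarrow> hoff" where
  "shuffle = bilinear_ext shuffle_words"

fun harmonic_indices :: "nat list \<Rightarrow> nat list \<Rightarrow> hoff" where
  "harmonic_indices [] w = idx w"
| "harmonic_indices v [] = idx v"
| "harmonic_indices (k # v) (l # w) =
     ek k * harmonic_indices v (l # w) + ek l * harmonic_indices (k # v) w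
     + ek (k + l) * harmonic_indices v w"

text \<open>
  The next two products are meaningful for arguments in \<open>H1\<close> and in \<open>e\<^sub>1 \<rat>\<langle>e\<^sub>0, e\<^sub>1\<rangle>\<close>, respectively.
\<close>

definition harmonic :: "hoff \<Rightarrow> hoff \<Rightarrow> hoff" where
  "harmonic = bilinear_ext (\<lambda>u v. harmonic_indices (word_index u) (word_index v))"

definition circledast :: "hoff \<Rightarrow> hoff \<Rightarrow> hoff" where
  "circledast = bilinear_ext (\<lambda>u v.
     let k = word_index u; l = word_index v
     in harmonic (idx (butlast k)) (idx (butlast l)) * ek (last k + last l))"

text \<open>In the last equation the first separator is a comma or a plus, respectively.\<close>

fun star_terms :: "nat list \<Rightarrow> nat list list" where
  "star_terms [] = []"
| "star_terms [a] = [[a]]"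
| "star_terms (a # b # l) = map ((#) a) (star_terms (b # l)) @ star_terms ((a + b) # l)"

definition star :: "nat list \<Rightarrow> hoff" where
  "star l = sum_list (map idx (star_terms l))"


definition two_poset :: "'a set \<Rightarrow> 'a rel \<Rightarrow> bool" where
  "two_poset X r \<longleftrightarrow> finite X \<and> partial_order_on X r"

definition linear_extensions :: "'a set \<Rightarrow> 'a rel \<Rightarrow> 'a list set" where
  "linear_extensions X r =
     {xs. distinct xs \<and> set xs = X \<and>
          (\<forall>i<length xs. \<forall>j<length xs. (xs ! i, xs ! j) \<in> r \<longrightarrow> i \<le> j)}"

definition poset_sum :: "'a set \<Rightarrow> 'a rel \<Rightarrow> ('a \<Rightarrow> letter) \<Rightarrow> hoff" where
  "poset_sum X r \<delta> = (\<Sum>xs\<in>linear_extensions X r. word (map \<delta> xs))"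

text \<open>
  All indices of \<open>NodeA\<close> and \<open>NodeB\<close> start from 1; the \<open>j\<close>-th entry of \<open>l\<close> is therefore \<open>l ! (j - 1)\<close>.
\<close>

datatype node = NodeA nat | NodeB nat nat

definition Q_carrier :: "nat list \<Rightarrow> nat list \<Rightarrow> node set" where
  "Q_carrier k l =
     {NodeA t | t. 1 \<le> t \<and> t \<le> sum_list k} \<union>
     {NodeB j i | j i. 1 \<le> j \<and> j \<le> length l \<and> 1 \<le> i \<and> i \<le> l ! (j - 1)}"

definition Q_generators :: "nat list \<Rightarrow> nat list \<Rightarrow> node rel" where
  "Q_generators k l =
     {(NodeA t, NodeA (t + 1)) | t. 1 \<le> t \<and> t < sum_list k} \<union>
     {(NodeA (sum_list k), NodeB (length l) 1)} \<union>
     {(NodeB j i, NodeB j (i + 1)) | j i. 1 \<le> j \<and> j \<le> length l \<and> 1 \<le> i \<and> i < l ! (j - 1)} \<union>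
     {(NodeB (j - 1) 1, NodeB j (l ! (j - 1))) | j. 2 \<le> j \<and> j \<le> length l}"

definition Q_order :: "nat list \<Rightarrow> nat list \<Rightarrow> node rel" where
  "Q_order k l = (Q_generators k l)\<^sup>* \<inter> Q_carrier k l \<times> Q_carrier k l"

fun Q_label :: "nat list \<Rightarrow> nat list \<Rightarrow> node \<Rightarrow> letter" where
  "Q_label k l (NodeA t) = (if t \<in> {sum_list (take i k) + 1 | i. i < length k} then E1 else E0)"
| "Q_label k l (NodeB j i) = (if i = 1 \<and> j < length l then E1 else E0)"

definition mu :: "nat list \<Rightarrow> nat list \<Rightarrow> hoff" where
  "mu k l = poset_sum (Q_carrier k l) (Q_order k l) (Q_label k l)"


lemma word_mult: "word u * word v = word (u @ v)"
  by (simp add: word_def mult_single plus_list_def)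

lemma word_Nil: "word [] = 1"
  by (simp add: word_def flip: zero_list_def)

lemma const_mult: "const c * word w = Poly_Mapping.single w c"
  by (simp add: word_def const_def mult_single plus_list_def)

lemma ek_eq_word: "ek k = word (E1 # replicate (k - 1) E0)"
proof -
  have "e0 ^ n = word (replicate n E0)" for n
    by (induction n) (simp_all add: word_Nil e0_def word_mult)
  then show ?thesis by (simp add: ek_def e1_def word_mult)
qed

lemma idx_eq_word: "idx k = word (index_word k)"
  by (induction k) (simp_all add: idx_def index_word_def word_Nil ek_eq_word word_mult)

lemma bilinear_ext_word: "bilinear_ext f (word u) (word v) = f u v"
  by (simp add: bilinear_ext_def word_def const_def flip: zero_list_def)

lemma index_word_inj:
  assumes "is_index k" "is_index l" "index_word k = index_word l"
  shows "k = l"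
  using assms
proof (induction k arbitrary: l)
  case Nil
  then show ?case by (cases l) (auto simp: index_word_def)
next
  case (Cons a k)
  then obtain b m where l: "l = b # m"
    by (cases l) (auto simp: index_word_def)
  have tw: "takeWhile (\<lambda>x. x = E0) (replicate n E0 @ index_word p) = replicate n E0" for n p
    by (induction n) (cases p; simp add: index_word_def)+
  have eq: "replicate (a - 1) E0 @ index_word k = replicate (b - 1) E0 @ index_word m"
    using Cons.prems(3) l by (simp add: index_word_def)
  from arg_cong[OF this, of "takeWhile (\<lambda>x. x = E0)"]
  have "a - 1 = b - 1" unfolding tw by (metis length_replicate)
  moreover have "0 < a" "0 < b" using Cons.prems l by (auto simp: is_index_def)
  moreover have "k = m"
    using Cons.IH[of m] Cons.prems l eq \<open>a - 1 = b - 1\<close> by (simp add: is_index_def)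
  ultimately show ?case using l by simp
qed

lemma word_index_index_word:
  assumes "is_index k" shows "word_index (index_word k) = k"
  unfolding word_index_def
  by (rule inv_into_f_f) (auto intro!: inj_onI index_word_inj assms)

lemma shuffle_word: "shuffle (word u) (word v) = shuffle_words u v"
  by (simp add: shuffle_def bilinear_ext_word)

lemma harmonic_idx:
  "is_index k \<Longrightarrow> is_index l \<Longrightarrow> harmonic (idx k) (idx l) = harmonic_indices k l"
  by (simp add: harmonic_def idx_eq_word bilinear_ext_word word_index_index_word)

lemma circledast_idx:
  assumes "is_index (v @ [k])" "is_index (w @ [l])"
  shows "circledast (idx (v @ [k])) (idx (w @ [l])) = harmonic (idx v) (idx w) * ek (k + l)"
  by (simp add: circledast_def idx_eq_word[of "v @ [k]"] idx_eq_word[of "w @ [l]"]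
      bilinear_ext_word word_index_index_word assms)

lemma two_poset_Q:
  shows "two_poset (Q_carrier k l) (Q_order k l)"
proof -
  define rank where
    "rank x = (case x of NodeA t \<Rightarrow> t | NodeB j i \<Rightarrow> sum_list k + 2 * j + i)" for x
  have "Q_carrier k l \<subseteq> NodeA ` {..sum_list k} \<union>
      (\<Union>j\<in>{..length l}. NodeB j ` {..l ! (j - 1)})"
    by (auto simp: Q_carrier_def)
  then have fin: "finite (Q_carrier k l)"
    by (rule finite_subset) auto
  have gen: "x = y \<or> rank x < rank y" if "(x, y) \<in> Q_generators k l" for x y
    using that by (auto simp: Q_generators_def rank_def)
  have le: "x = y \<or> rank x < rank y" if "(x, y) \<in> (Q_generators k l)\<^sup>*" for x y
    using that by (induction rule: rtrancl_induct) (use gen in fastforce)+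
  have "antisym ((Q_generators k l)\<^sup>*)"
    by (rule antisymI) (use le less_asym in blast)
  then have "antisym (Q_order k l)"
    by (auto simp: Q_order_def antisym_def)
  moreover have "trans (Q_order k l)"
    unfolding Q_order_def trans_def by (auto intro: rtrancl_trans)
  moreover have "refl_on (Q_carrier k l) (Q_order k l)"
    by (auto simp: refl_on_def Q_order_def)
  ultimately show ?thesis
    using fin by (auto simp: two_poset_def partial_order_on_def preorder_on_def Q_order_def)
qed

end

theory Submission
  imports Defs
begin

text \<open>
  For an index \<open>k\<close> with last entry \<open>p\<close> and an index \<open>l = (l\<^sub>1, \<dots>, l\<^sub>s)\<close>, both
  \<open>\<Sum>\<^sub>j (-1)\<^sup>j \<mu>(k, (l\<^sub>j, \<dots>, l\<^sub>1, m)) \<squnion> (l\<^sub>j\<^sub>+\<^sub>1, \<dots>, l\<^sub>s)\<close> (with \<open>\<squnion>\<close> the shuffle product) and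
  \<open>\<Sum>\<^sub>j (-1)\<^sup>j (k \<circledast> (l\<^sub>j, \<dots>, l\<^sub>1, m)\<^sup>\<star>) * (l\<^sub>j\<^sub>+\<^sub>1, \<dots>, l\<^sub>s)\<close> collapse to the same index, namely
  \<open>k\<close> with \<open>p\<close> replaced by \<open>p + m\<close>, followed by \<open>l\<close>: in the first sum, the linear extensions in
  which the next chain starts below or above the top of the previous one cancel in pairs; in the
  second, the same happens with the summation ranges \<open>\<ge>\<close> and \<open><\<close>. If \<open>Z\<close> satisfies the hypothesis
  and is multiplicative for one of the products, subtracting the two identities gives an alternating
  sum of multiplicativity defects for the other product. All terms but \<open>j = 0\<close> involve a second
  factor of smaller depth, so the remaining defect vanishes by induction on the depth.
\<close>

section \<open>Linear algebra of words\<close>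

lemma const_0 [simp]: "const 0 = 0"
  by (simp add: const_def)

lemma const_1: "const 1 = 1"
  by (simp add: const_def flip: zero_list_def)

lemma const_add: "const (a + b) = const a + const b"
  by (simp add: const_def single_add)

lemma const_mult_const: "const a * const b = const (a * b)"
  by (simp add: const_def mult_single plus_list_def)

lemma sum_monomials:
  "(\<Sum>w\<in>Poly_Mapping.keys x. Poly_Mapping.single w (Poly_Mapping.lookup x w)) = x"
  by (rule poly_mapping_eqI)
    (simp add: lookup_sum lookup_single when_def in_keys_iff)

text \<open>The scaled words range over the support of the fixed \<open>x\<close> only, so that a
  closure claim about \<open>x\<close> can be deduced from what its support contains.\<close>

lemma hoff_induct [case_names zero add scaled_word]:
  fixes x :: hoff
  assumes "P 0" "\<And>x y. P x \<Longrightarrow> P y \<Longrightarrow> P (x + y)" "\<And>c w. w \<in> Poly_Mapping.keys x \<Longrightarrow> P (const c * word w)"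
  shows "P x"
proof -
  have "P (\<Sum>w\<in>A. Poly_Mapping.single w (Poly_Mapping.lookup x w))"
    if "finite A" "A \<subseteq> Poly_Mapping.keys x" for A
    using that by (induction A) (auto simp: assms const_mult[symmetric])
  from this[of "Poly_Mapping.keys x"] show ?thesis
    by (simp add: sum_monomials)
qed

lemma const_commute: "x * const c = const c * x"
proof (induction x rule: hoff_induct)
  case (scaled_word d w)
  then show ?case
    by (simp add: const_mult) (simp add: const_def mult_single plus_list_def mult.commute)
qed (simp_all add: algebra_simps)

lemma const_left_commute: "x * (const c * y) = const c * (x * y)"
  by (metis const_commute mult.assoc)

section \<open>Linear and bilinear extension of functions on words\<close>

definition linear_ext :: "(letter list \<Rightarrow> hoff) \<Rightarrow> hoff \<Rightarrow> hoff" where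
  "linear_ext f x = (\<Sum>u\<in>Poly_Mapping.keys x. const (Poly_Mapping.lookup x u) * f u)"

lemma linear_ext_superset:
  assumes "finite A" "Poly_Mapping.keys x \<subseteq> A"
  shows "linear_ext f x = (\<Sum>u\<in>A. const (Poly_Mapping.lookup x u) * f u)"
  unfolding linear_ext_def using assms
  by (intro sum.mono_neutral_left) (auto simp: in_keys_iff)

lemma linear_ext_add: "linear_ext f (x + y) = linear_ext f x + linear_ext f y"
proof -
  let ?A = "Poly_Mapping.keys x \<union> Poly_Mapping.keys y"
  have "Poly_Mapping.keys (x + y) \<subseteq> ?A" by (rule Poly_Mapping.keys_add)
  then show ?thesis
    by (simp add: linear_ext_superset[of ?A] lookup_add const_add distrib_right sum.distrib)
qed

lemma linear_ext_scaled: "linear_ext f (const c * x) = const c * linear_ext f x"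
proof -
  have lk: "Poly_Mapping.lookup (const c * x) u = c * Poly_Mapping.lookup x u" for u
  proof (induction x rule: hoff_induct)
    case (scaled_word d w)
    then show ?case
      by (simp add: const_mult) (simp add: const_def mult_single plus_list_def lookup_single when_def)
  qed (simp_all add: lookup_add algebra_simps)
  then have "Poly_Mapping.keys (const c * x) \<subseteq> Poly_Mapping.keys x"
    by (auto simp: in_keys_iff)
  then show ?thesis
    by (simp add: linear_ext_superset[of "Poly_Mapping.keys x"] lk sum_distrib_left
        mult.assoc const_mult_const[symmetric])
qed

lemma bilinear_ext_eq_linear_ext:
  "bilinear_ext f x y = linear_ext (\<lambda>u. linear_ext (f u) y) x"
  by (simp add: bilinear_ext_def linear_ext_def sum_distrib_left mult.assoc const_mult_const[symmetric])

lemma bilinear_ext_add_left: "bilinear_ext f (x + x') y = bilinear_ext f x y + bilinear_ext f x' y"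
  by (simp add: bilinear_ext_eq_linear_ext linear_ext_add)

lemma bilinear_ext_scaled_left: "bilinear_ext f (const c * x) y = const c * bilinear_ext f x y"
  by (simp add: bilinear_ext_eq_linear_ext linear_ext_scaled)

lemma bilinear_ext_add_right: "bilinear_ext f x (y + y') = bilinear_ext f x y + bilinear_ext f x y'"
  by (simp add: bilinear_ext_eq_linear_ext linear_ext_add)
    (simp add: linear_ext_def distrib_left sum.distrib)

lemma bilinear_ext_scaled_right: "bilinear_ext f x (const c * y) = const c * bilinear_ext f x y"
  by (simp add: bilinear_ext_eq_linear_ext linear_ext_scaled)
    (simp only: linear_ext_def sum_distrib_left const_left_commute[of "const _" c])

locale bilinear_hoff =
  fixes b :: "hoff \<Rightarrow> hoff \<Rightarrow> hoff"
  assumes add_left: "b (x + x') y = b x y + b x' y"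
    and add_right: "b x (y + y') = b x y + b x y'"
    and scaled_left: "b (const c * x) y = const c * b x y"
    and scaled_right: "b x (const c * y) = const c * b x y"
begin

lemma zero_left [simp]: "b 0 y = 0"
  using add_left[of 0 0 y] by simp

lemma zero_right [simp]: "b x 0 = 0"
  using add_right[of x 0 0] by simp

lemma diff_right: "b x (y - y') = b x y - b x y'"
  using add_right[of x "y - y'" y'] by simp

lemma sum_left: "b (\<Sum>i\<in>A. f i) y = (\<Sum>i\<in>A. b (f i) y)"
  by (induction A rule: infinite_finite_induct) (simp_all add: add_left)

end

lemma bilinear_hoff_bilinear_ext: "bilinear_hoff (bilinear_ext f)"
  by standard
    (simp_all add: bilinear_ext_add_left bilinear_ext_add_right bilinear_ext_scaled_left
      bilinear_ext_scaled_right)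

interpretation shuffle: bilinear_hoff shuffle
  unfolding shuffle_def by (rule bilinear_hoff_bilinear_ext)

interpretation harmonic: bilinear_hoff harmonic
  unfolding harmonic_def by (rule bilinear_hoff_bilinear_ext)

interpretation circledast: bilinear_hoff circledast
  unfolding circledast_def by (rule bilinear_hoff_bilinear_ext)

section \<open>Alternating sums over the ways to cut a list\<close>

text \<open>This is the sum over all cuts \<open>p @ s\<close> of the list of \<open>f p s\<close>
  with sign \<open>(-1) ^ length p\<close>. Absorbing the first entry into \<open>f\<close> lets
  telescoping arguments run as plain list inductions with \<open>f\<close> arbitrary.\<close>

fun alt_cuts :: "('a list \<Rightarrow> 'a list \<Rightarrow> 'b::ab_group_add) \<Rightarrow> 'a list \<Rightarrow> 'b" where
  "alt_cuts f [] = f [] []"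
| "alt_cuts f (b # l) = f [] (b # l) - alt_cuts (\<lambda>p. f (b # p)) l"

lemma alt_cuts_cong:
  assumes "l = l'" "\<And>p s. p @ s = l' \<Longrightarrow> f p s = g p s"
  shows "alt_cuts f l = alt_cuts g l'"
  unfolding assms(1) using assms(2)
proof (induction l' arbitrary: f g)
  case (Cons b l)
  have "alt_cuts (\<lambda>p. f (b # p)) l = alt_cuts (\<lambda>p. g (b # p)) l"
    by (rule Cons.IH) (simp add: Cons.prems)
  then show ?case by (simp add: Cons.prems)
qed simp

lemma alt_cuts_add: "alt_cuts (\<lambda>p s. f p s + g p s) l = alt_cuts f l + alt_cuts g l"
  by (induction l arbitrary: f g) simp_all

text \<open>The set \<open>V\<close> is there because \<open>Z\<close> is only known to be additive
  on a subspace; closure under differences keeps all partial sums inside it.\<close>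

lemma alt_cuts_map_on:
  assumes "\<And>p s. p @ s = l \<Longrightarrow> f p s \<in> V"
    and "\<And>x y. x \<in> V \<Longrightarrow> y \<in> V \<Longrightarrow> x - y \<in> V"
    and "\<And>x y. x \<in> V \<Longrightarrow> y \<in> V \<Longrightarrow> T (x - y) = T x - T y"
  shows "alt_cuts f l \<in> V" "alt_cuts (\<lambda>p s. T (f p s)) l = T (alt_cuts f l)"
proof -
  have "alt_cuts f l \<in> V \<and> alt_cuts (\<lambda>p s. T (f p s)) l = T (alt_cuts f l)"
    using assms(1)
  proof (induction l arbitrary: f)
    case (Cons b l)
    have "alt_cuts (\<lambda>p. f (b # p)) l \<in> V \<and>
        alt_cuts (\<lambda>p s. T (f (b # p) s)) l = T (alt_cuts (\<lambda>p. f (b # p)) l)"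
      by (rule Cons.IH) (simp add: Cons.prems)
    then show ?case
      using Cons.prems[of "[]" "b # l"] assms(2,3) by simp
  qed simp
  then show "alt_cuts f l \<in> V" "alt_cuts (\<lambda>p s. T (f p s)) l = T (alt_cuts f l)" by auto
qed

lemma alt_cuts_map:
  assumes "\<And>x y. T (x - y) = T x - T y"
  shows "alt_cuts (\<lambda>p s. T (f p s)) l = T (alt_cuts f l)"
  using alt_cuts_map_on(2)[of l f UNIV T] assms by simp

text \<open>The added cut, the one with empty suffix, has sign
  \<open>(-1) ^ (length l + 1)\<close>.\<close>

lemma alt_cuts_snoc:
  "alt_cuts f (l @ [c]) = alt_cuts (\<lambda>p s. f p (s @ [c])) l
     + (if even (length l) then - f (l @ [c]) [] else f (l @ [c]) [])"
  by (induction l arbitrary: f) simp_all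

text \<open>All cuts with non-empty prefix cancel between the two sums. This is where an induction
  on the length of the suffix enters later.\<close>

lemma alt_cuts_eq_head:
  assumes "alt_cuts f l = alt_cuts g l"
    and "\<And>p s. p @ s = l \<Longrightarrow> p \<noteq> [] \<Longrightarrow> f p s = g p s"
  shows "f [] l = g [] l"
proof (cases l)
  case (Cons b l')
  have "alt_cuts (\<lambda>p. f (b # p)) l' = alt_cuts (\<lambda>p. g (b # p)) l'"
    by (rule alt_cuts_cong) (simp_all add: assms(2) Cons)
  then show ?thesis using assms(1) Cons by simp
qed (use assms in simp)

section \<open>Spans of indices\<close>

inductive_set idx_span :: "nat list set \<Rightarrow> hoff set" for S where
  zero [simp, intro]: "0 \<in> idx_span S"
| add [simp, intro]: "x \<in> idx_span S \<Longrightarrow> y \<in> idx_span S \<Longrightarrow> x + y \<in> idx_span S"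
| scaled_idx: "k \<in> S \<Longrightarrow> const c * idx k \<in> idx_span S"

lemma idx_span_scaled [simp, intro]: "x \<in> idx_span S \<Longrightarrow> const c * x \<in> idx_span S"
proof (induction rule: idx_span.induct)
  case (scaled_idx k d)
  then show ?case
    by (simp add: mult.assoc[symmetric] const_mult_const idx_span.scaled_idx)
qed (simp_all add: distrib_left)

lemma idx_in_idx_span [simp, intro]: "k \<in> S \<Longrightarrow> idx k \<in> idx_span S"
  using idx_span.scaled_idx[of k S 1] by (simp add: const_1)

lemma idx_span_diff [simp, intro]:
  assumes "x \<in> idx_span S" "y \<in> idx_span S" shows "x - y \<in> idx_span S"
proof -
  have "const 1 + const (- 1) = 0" by (simp add: const_add[symmetric])
  then have "const (- 1) = - 1" by (simp add: const_1 eq_neg_iff_add_eq_0 add.commute)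
  then have "x - y = x + const (- 1) * y" by simp
  then show ?thesis using assms by (metis idx_span.add idx_span_scaled)
qed

lemma idx_span_map:
  assumes "x \<in> idx_span S" "\<And>k. k \<in> S \<Longrightarrow> T (idx k) \<in> idx_span S'"
    and "T 0 = 0" "\<And>x y. T (x + y) = T x + T y" "\<And>c x. T (const c * x) = const c * T x"
  shows "T x \<in> idx_span S'"
  using assms(1) by induction (simp_all add: assms)

lemma (in bilinear_hoff) idx_span_closed:
  assumes "\<And>k l. k \<in> S \<Longrightarrow> l \<in> S' \<Longrightarrow> b (idx k) (idx l) \<in> idx_span S''"
    and "x \<in> idx_span S" "y \<in> idx_span S'"
  shows "b x y \<in> idx_span S''"
  using assms(2)
proof (rule idx_span_map[where T = "\<lambda>x. b x y"])
  show "b (idx k) y \<in> idx_span S''" if "k \<in> S" for k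
    using assms(3) by (rule idx_span_map) (auto simp: assms(1) that add_right scaled_right)
qed (auto simp: add_left scaled_left)

lemma idx_Nil: "idx [] = 1" by (simp add: idx_def)
lemma idx_Cons: "idx (a # k) = ek a * idx k" by (simp add: idx_def)
lemma idx_append: "idx (k @ l) = idx k * idx l" by (simp add: idx_def)
lemma idx_single: "idx [a] = ek a" by (simp add: idx_def)

section \<open>Identities between linear operators on spans\<close>

definition hlinear :: "(hoff \<Rightarrow> hoff) \<Rightarrow> bool" where
  "hlinear T \<longleftrightarrow> (\<forall>x y. T (x + y) = T x + T y) \<and> (\<forall>c x. T (const c * x) = const c * T x)"

named_theorems hlinear_intros

lemma hlinear_id [hlinear_intros]: "hlinear (\<lambda>x. x)"
  by (simp add: hlinear_def)

lemma hlinear_add [hlinear_intros]: "hlinear T \<Longrightarrow> hlinear T' \<Longrightarrow> hlinear (\<lambda>x. T x + T' x)"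
  by (simp add: hlinear_def algebra_simps)

lemma hlinear_mult_left [hlinear_intros]: "hlinear T \<Longrightarrow> hlinear (\<lambda>x. a * T x)"
  by (simp add: hlinear_def distrib_left const_left_commute[of a])

lemma hlinear_mult_right [hlinear_intros]: "hlinear T \<Longrightarrow> hlinear (\<lambda>x. T x * a)"
  by (simp add: hlinear_def distrib_right mult.assoc)

lemma (in bilinear_hoff) hlinear_left: "hlinear T \<Longrightarrow> hlinear (\<lambda>x. b (T x) y)"
  by (simp add: hlinear_def add_left scaled_left)

lemma (in bilinear_hoff) hlinear_right: "hlinear T \<Longrightarrow> hlinear (\<lambda>x. b y (T x))"
  by (simp add: hlinear_def add_right scaled_right)

lemmas [hlinear_intros] =
  shuffle.hlinear_left shuffle.hlinear_right harmonic.hlinear_left harmonic.hlinear_right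
  circledast.hlinear_left circledast.hlinear_right

text \<open>Used to lift multilinear identities from indices to spans, one argument at a time;
  \<open>hlinear_intros\<close> supplies linearity in the argument at hand.\<close>

lemma idx_span_eqI:
  assumes "x \<in> idx_span S" "hlinear T" "hlinear T'" "\<And>k. k \<in> S \<Longrightarrow> T (idx k) = T' (idx k)"
  shows "T x = T' x"
  using assms(1)
proof induction
  case zero
  have "T (0 + 0) = T 0 + T 0" "T' (0 + 0) = T' 0 + T' 0"
    using assms(2,3) unfolding hlinear_def by blast+
  then show ?case by simp
qed (use assms(2-4) in \<open>simp_all add: hlinear_def\<close>)

abbreviation "H1_span \<equiv> idx_span {k. is_index k}"
abbreviation "H0_span \<equiv> idx_span {k. admissible k}"

section \<open>The harmonic product\<close>

lemma is_index_simps [simp]: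
  "is_index []" "is_index (a # k) \<longleftrightarrow> 0 < a \<and> is_index k"
  "is_index (k @ l) \<longleftrightarrow> is_index k \<and> is_index l" "is_index (rev k) \<longleftrightarrow> is_index k"
  by (auto simp: is_index_def)

interpretation times: bilinear_hoff "(*)"
  by standard (simp_all add: distrib_left distrib_right mult.assoc const_left_commute)

lemma H1_span_mult [simp]: "x \<in> H1_span \<Longrightarrow> y \<in> H1_span \<Longrightarrow> x * y \<in> H1_span"
  by (erule (1) times.idx_span_closed[rotated]) (auto simp flip: idx_append)

lemma H1_span_1 [simp]: "1 \<in> H1_span"
  using idx_in_idx_span[of "[]" "{k. is_index k}"] by (simp add: idx_Nil)

lemma H1_span_ek [simp]: "0 < a \<Longrightarrow> ek a \<in> H1_span"
  using idx_in_idx_span[of "[a]" "{k. is_index k}"] by (simp add: idx_single)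

lemma harmonic_indices_Nil_right: "harmonic_indices k [] = idx k"
  by (cases k) simp_all

lemma harmonic_indices_in_H1_span: "is_index k \<Longrightarrow> is_index l \<Longrightarrow> harmonic_indices k l \<in> H1_span"
  by (induction k l rule: harmonic_indices.induct) auto

lemma H1_span_harmonic [simp]: "x \<in> H1_span \<Longrightarrow> y \<in> H1_span \<Longrightarrow> harmonic x y \<in> H1_span"
  by (erule (1) harmonic.idx_span_closed[rotated])
    (auto simp: harmonic_idx harmonic_indices_in_H1_span)

lemma harmonic_1_left [simp]: "x \<in> H1_span \<Longrightarrow> harmonic 1 x = x"
  by (erule idx_span_eqI) (auto intro!: hlinear_intros simp: harmonic_idx simp flip: idx_Nil)

lemma harmonic_1_right [simp]: "x \<in> H1_span \<Longrightarrow> harmonic x 1 = x"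
  by (erule idx_span_eqI)
    (auto intro!: hlinear_intros simp: harmonic_idx harmonic_indices_Nil_right simp flip: idx_Nil)

text \<open>The recursion on first entries implies the same recursion on last entries: when
  \<open>k\<close> and \<open>l\<close> are non-empty, each term of the defining recursion is
  expanded by induction. Star sums and \<open>circledast\<close> act on last entries, so this form
  is used later.\<close>

lemma harmonic_indices_snoc:
  "harmonic_indices (k @ [p]) (l @ [q]) =
     harmonic_indices k (l @ [q]) * ek p + harmonic_indices (k @ [p]) l * ek q
     + harmonic_indices k l * ek (p + q)"
proof (induction k l rule: harmonic_indices.induct)
  case (1 l)
  show ?case
    by (induction l) (simp_all add: idx_Cons idx_append idx_Nil algebra_simps)
next
  case (2 a k)
  show ?case
  proof (induction k arbitrary: a)
    case Nil
    then show ?case by (simp add: idx_Cons idx_append idx_Nil algebra_simps)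
  next
    case (Cons c k)
    show ?case using Cons[of c]
      by (simp add: idx_Cons idx_append idx_Nil harmonic_indices_Nil_right algebra_simps)
  qed
next
  case (3 a k b l)
  then show ?case by (simp add: algebra_simps)
qed

lemma harmonic_Cons:
  assumes "x \<in> H1_span" "y \<in> H1_span" "0 < a" "0 < b"
  shows "harmonic (ek a * x) (ek b * y) =
    ek a * harmonic x (ek b * y) + ek b * harmonic (ek a * x) y + ek (a + b) * harmonic x y"
  using assms(1)
proof (rule idx_span_eqI)
  fix k :: "nat list" assume k: "k \<in> {k. is_index k}"
  show "harmonic (ek a * idx k) (ek b * y) = ek a * harmonic (idx k) (ek b * y)
      + ek b * harmonic (ek a * idx k) y + ek (a + b) * harmonic (idx k) y"
    using assms(2)
    by (rule idx_span_eqI) 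
      (use k assms(3,4) in \<open>auto intro!: hlinear_intros simp: harmonic_idx simp flip: idx_Cons\<close>)
qed (intro hlinear_intros)+

lemma harmonic_snoc:
  assumes "x \<in> H1_span" "y \<in> H1_span" "0 < a" "0 < b"
  shows "harmonic (x * ek a) (y * ek b) =
    harmonic x (y * ek b) * ek a + harmonic (x * ek a) y * ek b + harmonic x y * ek (a + b)"
proof -
  have *: "idx k * ek c = idx (k @ [c])" for k c by (simp add: idx_append idx_single)
  show ?thesis using assms(1)
  proof (rule idx_span_eqI)
    fix k :: "nat list" assume k: "k \<in> {k. is_index k}"
    show "harmonic (idx k * ek a) (y * ek b) = harmonic (idx k) (y * ek b) * ek a
        + harmonic (idx k * ek a) y * ek b + harmonic (idx k) y * ek (a + b)"
      using assms(2)
      by (rule idx_span_eqI) 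
        (use k assms(3,4) in \<open>auto intro!: hlinear_intros simp: harmonic_idx * harmonic_indices_snoc\<close>)
  qed (intro hlinear_intros)+
qed

text \<open>Both bracketings expand into seven terms, one for each non-empty subset of the first
  entries \<open>a\<close>, \<open>b\<close>, \<open>c\<close> whose sum becomes the new first
  entry; the remaining products are shorter in total and agree by induction.\<close>

lemma harmonic_assoc_idx:
  assumes "is_index k" "is_index l" "is_index m"
  shows "harmonic (harmonic (idx k) (idx l)) (idx m) = harmonic (idx k) (harmonic (idx l) (idx m))"
  using assms
proof (induction "length k + length l + length m" arbitrary: k l m rule: less_induct)
  case less
  show ?case
  proof (cases "k = [] \<or> l = [] \<or> m = []")
    case True
    then show ?thesis using less.prems by (auto simp: idx_Nil)
  next
    case False
    then obtain a k' b l' c m' where eqs: "k = a # k'" "l = b # l'" "m = c # m'"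
      by (meson neq_Nil_conv)
    let ?k = "idx (a # k')" and ?l = "idx (b # l')" and ?m = "idx (c # m')"
    note IH = less.hyps[unfolded eqs]
    have ix: "0 < a" "0 < b" "0 < c" "is_index k'" "is_index l'" "is_index m'"
      using less.prems eqs by auto
    have kl: "harmonic ?k ?l = ek a * harmonic (idx k') ?l + ek b * harmonic ?k (idx l')
        + ek (a + b) * harmonic (idx k') (idx l')"
      using ix by (simp add: harmonic_Cons idx_Cons)
    have lm: "harmonic ?l ?m = ek b * harmonic (idx l') ?m + ek c * harmonic ?l (idx m')
        + ek (b + c) * harmonic (idx l') (idx m')"
      using ix by (simp add: harmonic_Cons idx_Cons)
    \<comment> \<open>Applying \<open>harmonic_Cons\<close> to each summand of \<open>kl\<close>
      yields three terms beginning with \<open>ek c\<close>; by \<open>kl\<close> again they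
      recombine to a single product with \<open>harmonic ?k ?l\<close>.\<close>
    have "harmonic (harmonic ?k ?l) ?m =
        ek a * harmonic (harmonic (idx k') ?l) ?m + ek b * harmonic (harmonic ?k (idx l')) ?m
      + ek (a + b) * harmonic (harmonic (idx k') (idx l')) ?m
      + ek c * harmonic (harmonic ?k ?l) (idx m')
      + ek (a + c) * harmonic (harmonic (idx k') ?l) (idx m')
      + ek (b + c) * harmonic (harmonic ?k (idx l')) (idx m')
      + ek (a + b + c) * harmonic (harmonic (idx k') (idx l')) (idx m')"
      unfolding kl unfolding idx_Cons[of c m']
      using ix by (simp add: harmonic.add_left harmonic_Cons algebra_simps)
    also have "\<dots> =
        ek a * harmonic (idx k') (harmonic ?l ?m) + ek b * harmonic ?k (harmonic (idx l') ?m)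
      + ek (a + b) * harmonic (idx k') (harmonic (idx l') ?m)
      + ek c * harmonic ?k (harmonic ?l (idx m'))
      + ek (a + c) * harmonic (idx k') (harmonic ?l (idx m'))
      + ek (b + c) * harmonic ?k (harmonic (idx l') (idx m'))
      + ek (a + b + c) * harmonic (idx k') (harmonic (idx l') (idx m'))"
      using ix by (simp add: IH)
    also have "\<dots> = harmonic ?k (harmonic ?l ?m)"
      unfolding lm unfolding idx_Cons[of a k']
      using ix by (simp add: harmonic.add_right harmonic_Cons algebra_simps)
    finally show ?thesis by (simp add: eqs)
  qed
qed

lemma harmonic_assoc:
  assumes "x \<in> H1_span" "y \<in> H1_span" "z \<in> H1_span"
  shows "harmonic (harmonic x y) z = harmonic x (harmonic y z)"
  using assms(1)
proof (rule idx_span_eqI)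
  fix k :: "nat list" assume k: "k \<in> {k. is_index k}"
  show "harmonic (harmonic (idx k) y) z = harmonic (idx k) (harmonic y z)"
    using assms(2)
  proof (rule idx_span_eqI)
    fix l :: "nat list" assume l: "l \<in> {k. is_index k}"
    show "harmonic (harmonic (idx k) (idx l)) z = harmonic (idx k) (harmonic (idx l) z)"
      using assms(3)
      by (rule idx_span_eqI) (use k l in \<open>auto intro!: hlinear_intros simp: harmonic_assoc_idx\<close>)
  qed (intro hlinear_intros)+
qed (intro hlinear_intros)+

section \<open>The star sums\<close>

lemma sum_list_map_mult: "sum_list (map (\<lambda>k. x * f k) ks) = x * (sum_list (map f ks) :: hoff)"
  by (induction ks) (simp_all add: distrib_left)

lemma star_single: "star [a] = ek a"
  by (simp add: star_def idx_single)

lemma star_Cons2: "star (a # b # l) = ek a * star (b # l) + star ((a + b) # l)"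
  by (simp add: star_def o_def idx_Cons sum_list_map_mult)

text \<open>The counterpart of \<open>star_Cons2\<close> at the other end. Induction is on the
  length because merging the first two entries gives a list that is shorter but not a tail of the
  original.\<close>

lemma star_snoc2: "star (l @ [b, m]) = star (l @ [b]) * ek m + star (l @ [b + m])"
proof (induction "length l" arbitrary: l b rule: less_induct)
  case less
  show ?case
  proof (cases l)
    case Nil
    then show ?thesis by (simp add: star_single star_Cons2)
  next
    case (Cons a l')
    show ?thesis
    proof (cases l')
      case Nil
      then show ?thesis
        using Cons less[of "[]" b] less[of "[]" "a + b"]
        by (simp add: star_single star_Cons2 algebra_simps)
    next
      case (Cons c l'')
      then show ?thesis
        using \<open>l = a # l'\<close> less[of l' b] less[of "(a + c) # l''" b]
        by (simp add: star_Cons2 algebra_simps)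
    qed
  qed
qed

lemma star_in_H1_span: "is_index l \<Longrightarrow> star l \<in> H1_span"
proof (induction l rule: star_terms.induct)
  case 1
  then show ?case by (simp add: star_def)
qed (auto simp: star_single star_Cons2)

text \<open>Up to the sign \<open>(-1) ^ length l\<close> this is the antipode of the harmonic Hopf
  algebra with deconcatenation as coproduct. The empty case is set apart because
  \<open>star []\<close> is 0.\<close>

definition rstar :: "nat list \<Rightarrow> hoff" where
  "rstar l = (if l = [] then 1 else star (rev l))"

lemma rstar_in_H1_span [simp]: "is_index l \<Longrightarrow> rstar l \<in> H1_span"
  by (simp add: rstar_def star_in_H1_span)

text \<open>
  With \<open>x = idx k\<close> and \<open>q = p + m\<close>, the following is the product of \<open>k @ [p]\<close> and the star sum of
  \<open>rev l @ [m]\<close> under \<open>\<circledast>\<close>, grouped by how many entries of \<open>l\<close> are merged into the last one.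
\<close>

fun star_glue :: "hoff \<Rightarrow> nat \<Rightarrow> nat list \<Rightarrow> hoff" where
  "star_glue x q [] = x * ek q"
| "star_glue x q (b # l) = harmonic x (rstar (b # l)) * ek q + star_glue x (q + b) l"

lemma rstar_Cons: "is_index l \<Longrightarrow> rstar (q # l) = star_glue 1 q l"
proof (induction l arbitrary: q)
  case (Cons b l)
  have "rstar (q # b # l) = rstar (b # l) * ek q + rstar ((q + b) # l)"
    by (simp add: rstar_def star_snoc2 add.commute)
  moreover have "harmonic 1 (rstar (b # l)) = rstar (b # l)" using Cons.prems by simp
  ultimately show ?case using Cons by simp
qed (simp add: rstar_def star_single)

lemma circledast_mult_ek:
  assumes "is_index (k @ [p])" "x \<in> H1_span" "0 < m"
  shows "circledast (idx (k @ [p])) (x * ek m) = harmonic (idx k) x * ek (p + m)"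
  using assms(2)
  by (rule idx_span_eqI)
    (use assms circledast_idx[of k p _ m] in
      \<open>auto intro!: hlinear_intros simp: idx_append[of _ "[m]"] idx_single\<close>)

text \<open>The separator before \<open>m\<close> decides: a comma makes \<open>rstar\<close> of the
  remaining entries a factor of the harmonic product, a plus enlarges \<open>m\<close> and leaves a
  shorter list.\<close>

lemma circledast_star:
  assumes "is_index (k @ [p])" "0 < m" "is_index l"
  shows "circledast (idx (k @ [p])) (star (rev l @ [m])) = star_glue (idx k) (p + m) l"
  using assms(2,3)
proof (induction l arbitrary: m)
  case Nil
  then show ?case
    using circledast_mult_ek[OF assms(1), of 1 m] assms(1) by (simp add: star_single)
next
  case (Cons b l)
  have "star (rev (b # l) @ [m]) = rstar (b # l) * ek m + star (rev l @ [m + b])"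
    using star_snoc2[of "rev l" b m] by (simp add: rstar_def add.commute)
  then show ?case
    using Cons assms(1) by (simp add: circledast.add_right circledast_mult_ek add.assoc)
qed

section \<open>The antipode relation and the collapse of the harmonic sum\<close>

definition antipode_sum :: "nat list \<Rightarrow> hoff" where
  "antipode_sum l = alt_cuts (\<lambda>p s. harmonic (rstar p) (idx s)) l"

text \<open>This is the part of the sum in \<open>alt_cuts_star_glue\<close> in which
  \<open>q\<close> absorbs no entry of the prefix.\<close>

definition glue_sum :: "hoff \<Rightarrow> nat \<Rightarrow> nat list \<Rightarrow> hoff" where
  "glue_sum x q l = alt_cuts (\<lambda>p s. harmonic (harmonic x (rstar p) * ek q) (idx s)) l"

text \<open>By \<open>harmonic_snoc\<close> each product with a suffix ending in \<open>c\<close>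
  splits by its last entry, which is \<open>q\<close>, \<open>c\<close> or \<open>q + c\<close>. The
  terms ending in \<open>q\<close> cancel against the cut with empty suffix, because the antipode
  sum of \<open>l @ [c]\<close> vanishes.\<close>

lemma glue_sum_snoc:
  assumes "x \<in> H1_span" "0 < q" "is_index l" "0 < c" "antipode_sum (l @ [c]) = 0"
  shows "glue_sum x q (l @ [c]) =
    glue_sum x q l * ek c + harmonic x (antipode_sum l) * ek (q + c)"
proof -
  let ?s = "\<lambda>y. if even (length l) then - y else (y :: hoff)"
  let ?r = "rstar (l @ [c])"
  have A: "alt_cuts (\<lambda>p s. harmonic (rstar p) (idx (s @ [c]))) l = - ?s ?r"
    using assms(3-5) alt_cuts_snoc[of "\<lambda>p s. harmonic (rstar p) (idx s)" l c]
    by (simp add: antipode_sum_def idx_Nil add_eq_0_iff2 split: if_splits)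
  have "glue_sum x q (l @ [c]) =
      alt_cuts (\<lambda>p s. harmonic (harmonic x (rstar p) * ek q) (idx (s @ [c]))) l
        + ?s (harmonic x ?r * ek q)"
    using assms(1-4) by (simp add: glue_sum_def alt_cuts_snoc idx_Nil)
  also have "alt_cuts (\<lambda>p s. harmonic (harmonic x (rstar p) * ek q) (idx (s @ [c]))) l =
      alt_cuts (\<lambda>p s. harmonic x (harmonic (rstar p) (idx (s @ [c]))) * ek q
        + harmonic (harmonic x (rstar p) * ek q) (idx s) * ek c
        + harmonic x (harmonic (rstar p) (idx s)) * ek (q + c)) l"
  proof (rule alt_cuts_cong)
    fix p s assume "p @ s = l"
    then have "is_index p" "is_index s" using assms(3) by auto
    then show "harmonic (harmonic x (rstar p) * ek q) (idx (s @ [c])) =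
        harmonic x (harmonic (rstar p) (idx (s @ [c]))) * ek q
        + harmonic (harmonic x (rstar p) * ek q) (idx s) * ek c
        + harmonic x (harmonic (rstar p) (idx s)) * ek (q + c)"
      using assms(1-4) by (simp add: idx_append idx_single harmonic_snoc harmonic_assoc)
  qed simp
  also have "\<dots> = harmonic x (- ?s ?r) * ek q + glue_sum x q l * ek c
      + harmonic x (antipode_sum l) * ek (q + c)"
    by (simp only: alt_cuts_add flip: A, simp only: glue_sum_def antipode_sum_def)
      (simp add: alt_cuts_map[where T = "\<lambda>y. harmonic x y * _"] alt_cuts_map[where T = "\<lambda>y. y * _"]
        harmonic.diff_right left_diff_distrib)
  finally show ?thesis
    using harmonic.diff_right[of x 0 ?r] by simp
qed

text \<open>The correction term in \<open>glue_sum_snoc\<close> survives only when \<open>l\<close>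
  is empty, that is for the first entry added; every later step appends an entry to both
  terms.\<close>

lemma glue_sum_eq:
  assumes "x \<in> H1_span" "0 < q" "is_index l"
    and "\<And>l'. length l' \<le> length l \<Longrightarrow> is_index l' \<Longrightarrow> antipode_sum l' = (if l' = [] then 1 else 0)"
  shows "glue_sum x q l = x * ek q * idx l + (case l of [] \<Rightarrow> 0 | b # l' \<Rightarrow> x * ek (q + b) * idx l')"
  using assms(3,4)
proof (induction l rule: rev_induct)
  case Nil
  then show ?case using assms(1,2) by (simp add: glue_sum_def rstar_def idx_Nil)
next
  case (snoc c l)
  have "glue_sum x q (l @ [c]) = glue_sum x q l * ek c + harmonic x (antipode_sum l) * ek (q + c)"
    using assms(1,2) snoc.prems by (intro glue_sum_snoc) auto
  moreover have "antipode_sum l = (if l = [] then 1 else 0)" using snoc.prems by simp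
  moreover have "glue_sum x q l =
      x * ek q * idx l + (case l of [] \<Rightarrow> 0 | b # l' \<Rightarrow> x * ek (q + b) * idx l')"
    using snoc by simp
  ultimately show ?case
    using assms(1)
    by (cases l) (simp_all add: idx_append idx_Cons idx_Nil algebra_simps)
qed

text \<open>
  The antipode relation for \<open>l\<close> follows from the next identity for the tail of \<open>l\<close> with \<open>x = 1\<close>, whence
  the hypothesis restricted to bounded length.
\<close>

lemma alt_cuts_star_glue_aux:
  assumes "x \<in> H1_span" "0 < q" "is_index l"
    and "\<And>l'. length l' \<le> length l \<Longrightarrow> is_index l' \<Longrightarrow> antipode_sum l' = (if l' = [] then 1 else 0)"
  shows "alt_cuts (\<lambda>p s. harmonic (star_glue x q p) (idx s)) l = x * ek q * idx l"
  using assms(2-4)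
proof (induction l arbitrary: q)
  case Nil
  then show ?case using assms(1) by (simp add: idx_Nil)
next
  case (Cons b l)
  \<comment> \<open>Prefixes that merge their first entry \<open>b\<close> into \<open>q\<close>
    give the same sum for \<open>q + b\<close> and the tail, with the opposite sign; its value
    cancels the second term of \<open>glue_sum_eq\<close>.\<close>
  have "alt_cuts (\<lambda>p s. harmonic (star_glue x q p) (idx s)) (b # l) =
      glue_sum x q (b # l) - alt_cuts (\<lambda>p s. harmonic (star_glue x (q + b) p) (idx s)) l"
    using assms(1) by (simp add: glue_sum_def harmonic.add_left alt_cuts_add rstar_def)
  moreover have "alt_cuts (\<lambda>p s. harmonic (star_glue x (q + b) p) (idx s)) l = x * ek (q + b) * idx l"
    using Cons by simp
  moreover have "glue_sum x q (b # l) = x * ek q * idx (b # l) + x * ek (q + b) * idx l"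
    using glue_sum_eq[OF assms(1) Cons.prems] by simp
  ultimately show ?case by simp
qed

text \<open>Convolution of the antipode with the identity is the counit. For
  \<open>l = q # m\<close> the cuts with non-empty prefix sum up, by \<open>rstar_Cons\<close> and
  the identity for \<open>m\<close> with \<open>x = 1\<close>, to \<open>idx l\<close>, which
  cancels the cut with empty prefix.\<close>

lemma antipode_sum_eq: "is_index l \<Longrightarrow> antipode_sum l = (if l = [] then 1 else 0)"
proof (induction "length l" arbitrary: l rule: less_induct)
  case less
  show ?case
  proof (cases l)
    case Nil
    then show ?thesis by (simp add: antipode_sum_def rstar_def idx_Nil)
  next
    case (Cons q m)
    have "alt_cuts (\<lambda>p s. harmonic (rstar (q # p)) (idx s)) m =
        alt_cuts (\<lambda>p s. harmonic (star_glue 1 q p) (idx s)) m"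
      using less.prems Cons by (intro alt_cuts_cong) (auto simp: rstar_Cons)
    also have "\<dots> = 1 * ek q * idx m"
      using less Cons by (intro alt_cuts_star_glue_aux) auto
    finally show ?thesis
      using less.prems Cons by (simp add: antipode_sum_def rstar_def[of "[]"] idx_Cons)
  qed
qed

lemma alt_cuts_star_glue:
  assumes "x \<in> H1_span" "0 < q" "is_index l"
  shows "alt_cuts (\<lambda>p s. harmonic (star_glue x q p) (idx s)) l = x * ek q * idx l"
  using assms by (intro alt_cuts_star_glue_aux antipode_sum_eq)

lemma alt_cuts_circledast:
  assumes "is_index (k @ [p])" "0 < m" "is_index l"
  shows "alt_cuts (\<lambda>u s. harmonic (circledast (idx (k @ [p])) (star (rev u @ [m]))) (idx s)) l =
    idx (k @ [p + m] @ l)"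
proof -
  have "alt_cuts (\<lambda>u s. harmonic (circledast (idx (k @ [p])) (star (rev u @ [m]))) (idx s)) l =
      alt_cuts (\<lambda>u s. harmonic (star_glue (idx k) (p + m) u) (idx s)) l"
    using assms by (intro alt_cuts_cong) (auto simp: circledast_star)
  then show ?thesis
    using assms by (simp add: alt_cuts_star_glue idx_append idx_single idx_Cons mult.assoc)
qed

section \<open>Zigzag posets\<close>

lemma shuffle_words_Nil_right: "shuffle_words u [] = word u"
  by (cases u) simp_all

lemma shuffle_1_left: "shuffle 1 x = x"
proof (induction x rule: hoff_induct)
  case (scaled_word c w)
  then show ?case by (simp add: shuffle.scaled_right shuffle_word flip: word_Nil)
qed (simp_all add: shuffle.add_right)

lemma shuffle_1_right: "shuffle x 1 = x"
proof (induction x rule: hoff_induct)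
  case (scaled_word c w)
  then show ?case
    by (simp add: shuffle.scaled_left shuffle_word shuffle_words_Nil_right flip: word_Nil)
qed (simp_all add: shuffle.add_left)

text \<open>
  Words are listed from the last chain of the zigzag to the first. The recursion removes the
  relation that the bottom of \<open>v\<close> is below the top of \<open>u\<close> by subtracting the linear extensions with
  the opposite relation, which fuses both chains into one.
\<close>

fun zigzag :: "letter list list \<Rightarrow> hoff" where
  "zigzag [] = 1"
| "zigzag [w] = word w"
| "zigzag (v # u # ws) = shuffle (zigzag (u # ws)) (word v) - zigzag ((u @ v) # ws)"

text \<open>By induction, the cuts with non-empty prefix give the zigzag in which all words of the
  list are fused into one chain attached to \<open>u\<close>. By the third equation of
  \<open>zigzag\<close> this is the cut with empty prefix minus the zigzag in which everything is
  fused to \<open>u\<close>.\<close>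

lemma alt_cuts_zigzag:
  "alt_cuts (\<lambda>p s. shuffle (zigzag (rev (map f p) @ u # ws)) (word (concat (map f s)))) l =
     zigzag ((u @ concat (map f l)) # ws)"
proof (induction l arbitrary: u ws)
  case Nil
  then show ?case by (simp add: shuffle_1_right word_Nil)
next
  case (Cons a l)
  then show ?case by simp
qed

section \<open>Linear extensions of relations\<close>

definition chain_rel :: "'a list \<Rightarrow> 'a rel" where
  "chain_rel v = set (zip v (tl v))"

lemma chain_rel_simps [simp]:
  "chain_rel [] = {}" "chain_rel [x] = {}"
  "chain_rel (x # y # v) = insert (x, y) (chain_rel (y # v))"
  by (simp_all add: chain_rel_def)

lemma linear_extensions_sorted_wrt:
  "linear_extensions X R = {xs. distinct xs \<and> set xs = X \<and> sorted_wrt (\<lambda>a b. (b, a) \<notin> R) xs}"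
  unfolding linear_extensions_def sorted_wrt_iff_nth_less
  by (auto simp: not_less[symmetric]) (meson less_trans)

lemma finite_linear_extensions [simp]: "finite X \<Longrightarrow> finite (linear_extensions X R)"
  by (rule finite_subset[OF _ finite_lists_length_eq[of X "card X"]])
    (auto simp: linear_extensions_def distinct_card)

text \<open>Along a path of relations the positions in the list increase weakly. Hence generators
  may replace the order they generate.\<close>

lemma linear_extensions_rtrancl:
  assumes "R \<subseteq> X \<times> X"
  shows "linear_extensions X (R\<^sup>* \<inter> X \<times> X) = linear_extensions X R"
proof
  show "linear_extensions X (R\<^sup>* \<inter> X \<times> X) \<subseteq> linear_extensions X R"
    using assms by (auto simp: linear_extensions_def)
  show "linear_extensions X R \<subseteq> linear_extensions X (R\<^sup>* \<inter> X \<times> X)"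
  proof
    fix xs assume xs: "xs \<in> linear_extensions X R"
    have "\<exists>j<length xs. y = xs ! j \<and> i \<le> j" if "i < length xs" "(xs ! i, y) \<in> R\<^sup>*" for i y
      using that(2)
    proof (induction rule: rtrancl_induct)
      case base
      then show ?case using that(1) by auto
    next
      case (step y z)
      then obtain j where j: "j < length xs" "y = xs ! j" "i \<le> j" by blast
      have "z \<in> set xs" using step(2) assms xs by (auto simp: linear_extensions_def)
      then obtain j' where "j' < length xs" "z = xs ! j'" by (metis in_set_conv_nth)
      moreover from this have "j \<le> j'" using xs step(2) j by (auto simp: linear_extensions_def)
      ultimately show ?case using j by auto
    qed
    then show "xs \<in> linear_extensions X (R\<^sup>* \<inter> X \<times> X)"
      using xs by (fastforce simp: linear_extensions_def nth_eq_iff_index_eq)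
  qed
qed

text \<open>Exactly one of the two elements comes first in a given linear extension. As
  \<open>R\<close> is merely a set of constraints, the enlarged relations are not closed
  transitively.\<close>

lemma poset_sum_split:
  assumes "finite X" "x \<in> X" "y \<in> X" "x \<noteq> y"
  shows "poset_sum X R d = poset_sum X (insert (x, y) R) d + poset_sum X (insert (y, x) R) d"
proof -
  have "xs \<in> linear_extensions X (insert (x, y) R) \<union> linear_extensions X (insert (y, x) R)"
    if xs: "xs \<in> linear_extensions X R" for xs
  proof -
    obtain i j where "i < length xs" "xs ! i = x" "j < length xs" "xs ! j = y"
      using assms xs by (auto simp: linear_extensions_def) (metis in_set_conv_nth)
    then show ?thesis
      using xs by (cases "i \<le> j") (auto simp: linear_extensions_def nth_eq_iff_index_eq)
  qed
  moreover have "linear_extensions X (insert (x, y) R) \<inter> linear_extensions X (insert (y, x) R) = {}"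
  proof (rule ccontr)
    assume "\<not> ?thesis"
    then obtain xs where xs: "xs \<in> linear_extensions X (insert (x, y) R)"
      "xs \<in> linear_extensions X (insert (y, x) R)" by blast
    obtain i j where "i < length xs" "xs ! i = x" "j < length xs" "xs ! j = y"
      using assms xs by (auto simp: linear_extensions_def) (metis in_set_conv_nth)
    then have "i = j" using xs by (force simp: linear_extensions_def intro!: le_antisym)
    then show False using \<open>xs ! i = x\<close> \<open>xs ! j = y\<close> assms(4) by simp
  qed
  moreover have "linear_extensions X (insert (x, y) R) \<union> linear_extensions X (insert (y, x) R)
      \<subseteq> linear_extensions X R"
    by (auto simp: linear_extensions_def)
  ultimately have "linear_extensions X R =
      linear_extensions X (insert (x, y) R) \<union> linear_extensions X (insert (y, x) R)" by blast
  then show ?thesis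
    unfolding poset_sum_def
    using \<open>_ \<inter> _ = {}\<close> assms(1) by (simp add: sum.union_disjoint)
qed

text \<open>\<open>shuffles\<close> is a set, so multiplicities survive only because the lists have
  no common entry; the labels under \<open>d\<close> may coincide and then contribute the same word
  several times.\<close>

lemma shuffle_words_eq_sum:
  assumes "set xs \<inter> set ys = {}"
  shows "shuffle_words (map d xs) (map d ys) = (\<Sum>zs\<in>shuffles xs ys. word (map d zs))"
  using assms
proof (induction xs ys rule: shuffles.induct)
  case (3 x xs y ys)
  have "(\<Sum>zs\<in>shuffles (x # xs) (y # ys). word (map d zs)) =
      (\<Sum>zs\<in>(#) x ` shuffles xs (y # ys). word (map d zs))
      + (\<Sum>zs\<in>(#) y ` shuffles (x # xs) ys. word (map d zs))"
    using 3(3) by (auto intro!: sum.union_disjoint)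
  also have "\<dots> = word [d x] * (\<Sum>zs\<in>shuffles xs (y # ys). word (map d zs))
      + word [d y] * (\<Sum>zs\<in>shuffles (x # xs) ys. word (map d zs))"
    by (simp add: sum.reindex inj_on_def sum_distrib_left word_mult)
  finally show ?case using 3 by simp
qed (simp_all add: shuffle_words_Nil_right)

lemma sorted_wrt_shuffles:
  assumes "zs \<in> shuffles xs ys" "sorted_wrt P xs" "sorted_wrt P ys"
    and "\<And>x y. x \<in> set xs \<Longrightarrow> y \<in> set ys \<Longrightarrow> P x y \<and> P y x"
  shows "sorted_wrt P zs"
  using assms
proof (induction xs ys arbitrary: zs rule: shuffles.induct)
  case (3 x xs y ys)
  from 3(3) consider zs' where "zs = x # zs'" "zs' \<in> shuffles xs (y # ys)"
    | zs' where "zs = y # zs'" "zs' \<in> shuffles (x # xs) ys" by auto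
  then show ?case
  proof cases
    case 1
    then show ?thesis using 3(1)[of zs'] 3(4-6) set_shuffles[OF 1(2)] by auto
  next
    case 2
    then show ?thesis using 3(2)[of zs'] 3(4-6) set_shuffles[OF 2(2)] by auto
  qed
qed auto

lemma chain_rel_subset: "chain_rel v \<subseteq> set v \<times> set v"
  by (cases v) (auto simp: chain_rel_def dest: set_zip_leftD set_zip_rightD)

lemma sorted_wrt_chain_rel: "distinct v \<Longrightarrow> sorted_wrt (\<lambda>a b. (b, a) \<notin> chain_rel v) v"
proof (induction v)
  case (Cons x v)
  have "(b, x) \<notin> chain_rel (x # v)" if "b \<in> set v" for b
    using Cons.prems by (auto simp: chain_rel_def dest: set_zip_rightD)
  moreover have "sorted_wrt (\<lambda>a b. (b, a) \<notin> chain_rel (x # v)) v"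
    by (rule sorted_wrt_mono_rel[OF _ Cons.IH]) (use Cons.prems in \<open>cases v; auto\<close>)+
  ultimately show ?case by simp
qed simp

text \<open>Deleting the first chain element \<open>x\<close> from \<open>ws\<close> leaves the rest
  of the chain, by induction. Anything in front of \<open>x\<close> would then include the successor
  of \<open>x\<close>.\<close>

lemma sorted_wrt_chain_rel_unique:
  assumes "distinct v" "distinct ws" "set ws = set v" "sorted_wrt (\<lambda>a b. (b, a) \<notin> chain_rel v) ws"
  shows "ws = v"
  using assms
proof (induction v arbitrary: ws)
  case (Cons x v)
  then obtain as bs where ws: "ws = as @ x # bs"
    by (metis list.set_intros(1) split_list)
  have "as @ bs = v"
  proof (rule Cons.IH)
    have "chain_rel v \<subseteq> chain_rel (x # v)" by (cases v) auto
    then show "sorted_wrt (\<lambda>a b. (b, a) \<notin> chain_rel v) (as @ bs)"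
      using Cons.prems(4) ws by (auto simp: sorted_wrt_append intro: sorted_wrt_mono_rel[rotated])
  qed (use Cons.prems ws in auto)
  moreover have "as = []"
  proof (cases as)
    case (Cons y as')
    then have "(x, y) \<in> chain_rel (x # v)" using \<open>as @ bs = v\<close> by auto
    then show ?thesis using Cons.prems(4) ws Cons by auto
  qed
  ultimately show ?case using ws by simp
qed simp

text \<open>No constraint relates the two parts, so a linear extension is an arbitrary interleaving
  of its restrictions to \<open>X\<close> and to the chain, and the latter can only be
  \<open>v\<close> itself.\<close>

lemma linear_extensions_chain_union:
  assumes "R \<subseteq> X \<times> X" "distinct v" "X \<inter> set v = {}"
  shows "linear_extensions (X \<union> set v) (R \<union> chain_rel v) = (\<Union>xs\<in>linear_extensions X R. shuffles xs v)"
proof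
  let ?P = "\<lambda>a b. (b, a) \<notin> R \<union> chain_rel v"
  note cv = chain_rel_subset[of v]
  show "linear_extensions (X \<union> set v) (R \<union> chain_rel v) \<subseteq> (\<Union>xs\<in>linear_extensions X R. shuffles xs v)"
  proof
    fix zs assume "zs \<in> linear_extensions (X \<union> set v) (R \<union> chain_rel v)"
    then have zs: "distinct zs" "set zs = X \<union> set v" "sorted_wrt ?P zs"
      by (auto simp: linear_extensions_sorted_wrt)
    have "sorted_wrt ?P (filter (\<lambda>x. x \<in> X) zs)" "sorted_wrt ?P (filter (\<lambda>x. x \<notin> X) zs)"
      using zs(3) by (rule sorted_wrt_filter)+
    then have s: "sorted_wrt (\<lambda>a b. (b, a) \<notin> R) (filter (\<lambda>x. x \<in> X) zs)"
      "sorted_wrt (\<lambda>a b. (b, a) \<notin> chain_rel v) (filter (\<lambda>x. x \<notin> X) zs)"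
      by (auto elim: sorted_wrt_mono_rel[rotated])
    have "filter (\<lambda>x. x \<notin> X) zs = v"
      using assms zs s(2) by (intro sorted_wrt_chain_rel_unique) auto
    moreover have "filter (\<lambda>x. x \<in> X) zs \<in> linear_extensions X R"
      using zs s(1) by (auto simp: linear_extensions_sorted_wrt)
    ultimately show "zs \<in> (\<Union>xs\<in>linear_extensions X R. shuffles xs v)"
      using partition_in_shuffles[of zs "\<lambda>x. x \<in> X"] by auto
  qed
  show "(\<Union>xs\<in>linear_extensions X R. shuffles xs v) \<subseteq> linear_extensions (X \<union> set v) (R \<union> chain_rel v)"
  proof
    fix zs assume "zs \<in> (\<Union>xs\<in>linear_extensions X R. shuffles xs v)"
    then obtain xs where xs: "distinct xs" "set xs = X" "sorted_wrt (\<lambda>a b. (b, a) \<notin> R) xs"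
      and zs: "zs \<in> shuffles xs v"
      by (auto simp: linear_extensions_sorted_wrt)
    have "sorted_wrt ?P zs"
    proof (rule sorted_wrt_shuffles[OF zs])
      show "sorted_wrt ?P xs"
        by (rule sorted_wrt_mono_rel[OF _ xs(3)]) (use cv assms(3) xs(2) in auto)
      show "sorted_wrt ?P v"
        by (rule sorted_wrt_mono_rel[OF _ sorted_wrt_chain_rel[OF assms(2)]]) (use assms in auto)
      show "?P x y \<and> ?P y x" if "x \<in> set xs" "y \<in> set v" for x y
        using that assms cv xs(2) by auto
    qed
    then show "zs \<in> linear_extensions (X \<union> set v) (R \<union> chain_rel v)"
      using distinct_disjoint_shuffles[OF xs(1) assms(2) _ zs] set_shuffles[OF zs] xs(2) assms(3)
      by (auto simp: linear_extensions_sorted_wrt)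
  qed
qed

lemma shuffle_poset_sum:
  assumes "finite X" "R \<subseteq> X \<times> X" "distinct v" "X \<inter> set v = {}"
  shows "shuffle (poset_sum X R d) (word (map d v)) = poset_sum (X \<union> set v) (R \<union> chain_rel v) d"
proof -
  have X: "set xs = X" if "xs \<in> linear_extensions X R" for xs
    using that by (simp add: linear_extensions_def)
  have "shuffle (poset_sum X R d) (word (map d v)) =
      (\<Sum>xs\<in>linear_extensions X R. \<Sum>zs\<in>shuffles xs v. word (map d zs))"
    unfolding poset_sum_def shuffle.sum_left
    by (rule sum.cong) (use X assms(4) in \<open>auto simp: shuffle_word intro!: shuffle_words_eq_sum\<close>)
  also have "\<dots> = poset_sum (X \<union> set v) (R \<union> chain_rel v) d"
    unfolding poset_sum_def linear_extensions_chain_union[OF assms(2-4)]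
  proof (rule sum.UNION_disjoint[symmetric])
    show "\<forall>xs\<in>linear_extensions X R. \<forall>ys\<in>linear_extensions X R.
        xs \<noteq> ys \<longrightarrow> shuffles xs v \<inter> shuffles ys v = {}"
    proof (intro ballI impI, rule ccontr)
      fix xs ys assume *: "xs \<in> linear_extensions X R" "ys \<in> linear_extensions X R" "xs \<noteq> ys"
        "shuffles xs v \<inter> shuffles ys v \<noteq> {}"
      then obtain zs where "zs \<in> shuffles xs v" "zs \<in> shuffles ys v" by blast
      \<comment> \<open>Filtering by \<open>X\<close> recovers a linear extension from any of its
        shuffles with \<open>v\<close>.\<close>
      then have "filter (\<lambda>x. x \<in> X) zs = xs" "filter (\<lambda>x. x \<in> X) zs = ys"
        using X *(1,2) assms(4) filter_shuffles_disjoint1(1) by metis+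
      then show False using *(3) by simp
    qed
  qed (use assms(1) in auto)
  finally show ?thesis .
qed

section \<open>Poset sums of zigzags\<close>

definition zigzag_gens :: "'a list list \<Rightarrow> 'a rel" where
  "zigzag_gens cs = (\<Union>c\<in>set cs. chain_rel c) \<union> (\<lambda>(v, u). (hd v, last u)) ` set (zip cs (tl cs))"

lemma zigzag_gens_subset:
  assumes "[] \<notin> set cs" shows "zigzag_gens cs \<subseteq> set (concat cs) \<times> set (concat cs)"
proof -
  have "v \<in> set cs \<and> u \<in> set cs" if "(v, u) \<in> set (zip cs (tl cs))" for v u
    using that by (cases cs) (auto dest: set_zip_leftD set_zip_rightD)
  moreover have "hd v \<in> set (concat cs)" "last v \<in> set (concat cs)" if "v \<in> set cs" for v
    using that assms hd_in_set[of v] last_in_set[of v] by (metis UN_I set_concat)+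
  ultimately show ?thesis
    unfolding zigzag_gens_def using chain_rel_subset by fastforce
qed

lemma chain_rel_append:
  "u \<noteq> [] \<Longrightarrow> v \<noteq> [] \<Longrightarrow> chain_rel (u @ v) = insert (last u, hd v) (chain_rel u \<union> chain_rel v)"
proof (induction u)
  case (Cons x u)
  then show ?case by (cases u; cases v) auto
qed simp

text \<open>Without its link to \<open>u\<close>, the chain \<open>v\<close> is unrelated to the
  rest and contributes a shuffle product. Splitting by the order of \<open>hd v\<close> and
  \<open>last u\<close> gives the zigzag and the relation with the opposite link, under which
  \<open>u @ v\<close> is a single chain; this is the recursion of \<open>zigzag\<close>.\<close>

lemma poset_sum_zigzag:
  fixes cs :: "'a list list"
  assumes "distinct (concat cs)" "[] \<notin> set cs"
  shows "poset_sum (set (concat cs)) (zigzag_gens cs) d = zigzag (map (map d) cs)"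
  using assms
proof (induction "length cs" arbitrary: cs rule: less_induct)
  case less
  have empty: "poset_sum {} {} d = 1"
  proof -
    have "linear_extensions {} {} = {[] :: 'a list}" by (auto simp: linear_extensions_def)
    then show ?thesis by (simp add: poset_sum_def word_Nil)
  qed
  consider "cs = []" | w where "cs = [w]" | v u ws where "cs = v # u # ws"
    by (metis neq_Nil_conv)
  then show ?case
  proof cases
    case 1
    then show ?thesis by (simp add: zigzag_gens_def empty)
  next
    case 2
    then show ?thesis
      using shuffle_poset_sum[of "{}" "{}" w d] less.prems by (simp add: zigzag_gens_def empty shuffle_1_left)
  next
    case 3
    let ?X = "set (concat (u # ws))"
    let ?R = "zigzag_gens (u # ws) \<union> chain_rel v"
    have ne: "u \<noteq> []" "v \<noteq> []" using less.prems 3 by auto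
    have d: "distinct (concat (u # ws))" "[] \<notin> set (u # ws)" "distinct v" "?X \<inter> set v = {}"
      "distinct (concat ((u @ v) # ws))" "[] \<notin> set ((u @ v) # ws)"
      using less.prems 3 by auto
    have "hd v \<noteq> last u" using d(4) ne by (metis IntI UnCI concat.simps(2) empty_iff hd_in_set last_in_set set_append)
    have "shuffle (zigzag (map (map d) (u # ws))) (word (map d v)) = poset_sum (?X \<union> set v) ?R d"
      using shuffle_poset_sum[OF _ zigzag_gens_subset d(3,4), where d = d] less.hyps[of "u # ws"] d 3 by simp
    also have "\<dots> = poset_sum (?X \<union> set v) (insert (hd v, last u) ?R) d
        + poset_sum (?X \<union> set v) (insert (last u, hd v) ?R) d"
      using \<open>hd v \<noteq> last u\<close> ne by (intro poset_sum_split) auto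
    also have "insert (hd v, last u) ?R = zigzag_gens cs"
      by (auto simp: zigzag_gens_def 3)
    also have "insert (last u, hd v) ?R = zigzag_gens ((u @ v) # ws)"
      using ne by (cases ws) (auto simp: zigzag_gens_def chain_rel_append)
    also have "?X \<union> set v = set (concat ((u @ v) # ws))" by auto
    also have "poset_sum (set (concat ((u @ v) # ws))) (zigzag_gens ((u @ v) # ws)) d =
        zigzag (map (map d) ((u @ v) # ws))"
      using d(5,6) 3 by (intro less.hyps) simp_all
    also have "set (concat ((u @ v) # ws)) = set (concat cs)" using 3 by auto
    finally show ?thesis using 3 by simp
  qed
qed

section \<open>The poset \<open>Q\<close> as a zigzag\<close>

lemma chain_rel_map_upt:
  "chain_rel (map f [1..<Suc n]) = {(f i, f (i + 1)) | i. 1 \<le> i \<and> i < n}"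
proof -
  have "chain_rel xs = {(xs ! i, xs ! Suc i) | i. Suc i < length xs}" for xs :: "'a list"
    by (fastforce simp: chain_rel_def set_zip nth_tl)
  note this[of "map f [1..<Suc n]"]
  also have "{(map f [1..<Suc n] ! i, map f [1..<Suc n] ! Suc i) | i. Suc i < length (map f [1..<Suc n])} =
      {(f i, f (i + 1)) | i. 1 \<le> i \<and> i < n}"
  proof safe
    fix i assume "1 \<le> i" "i < n"
    then show "\<exists>j. (f i, f (i + 1)) = (map f [1..<Suc n] ! j, map f [1..<Suc n] ! Suc j) \<and>
        Suc j < length (map f [1..<Suc n])"
      by (intro exI[of _ "i - 1"]) (simp del: upt_Suc)
  next
    fix i assume "Suc i < length (map f [1..<Suc n])"
    then show "\<exists>j. (map f [1..<Suc n] ! i, map f [1..<Suc n] ! Suc i) = (f j, f (j + 1)) \<and> 1 \<le> j \<and> j < n"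
      by (intro exI[of _ "Suc i"]) (simp del: upt_Suc)
  qed
  finally show ?thesis .
qed

lemma map_label_upt:
  assumes "is_index k"
  shows "map (\<lambda>t. if t \<in> {sum_list (take i k) + 1 | i. i < length k} then E1 else E0)
      [1..<Suc (sum_list k)] = index_word k"
  using assms
proof (induction k)
  case Nil
  then show ?case by (simp add: index_word_def)
next
  case (Cons a k)
  let ?S = "\<lambda>k. {sum_list (take i k) + 1 | i. i < length k}"
  \<comment> \<open>\<open>?S k\<close> collects the positions at which the blocks of
    \<open>index_word k\<close> start, counted from 1.\<close>
  have S: "?S (a # k) = insert 1 ((\<lambda>t. t + a) ` ?S k)"
  proof safe
    fix i assume "i < length (a # k)" "sum_list (take i (a # k)) + 1 \<notin> (\<lambda>t. t + a) ` ?S k"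
    then show "sum_list (take i (a # k)) + 1 = 1" by (cases i) auto
  next
    show "\<exists>i. 1 = sum_list (take i (a # k)) + 1 \<and> i < length (a # k)"
      by (intro exI[of _ 0]) simp
  next
    fix i assume "i < length k"
    then show "\<exists>j. sum_list (take i k) + 1 + a = sum_list (take j (a # k)) + 1 \<and> j < length (a # k)"
      by (intro exI[of _ "Suc i"]) simp
  qed
  have "0 < a" using Cons.prems by simp
  have *: "map (\<lambda>t. t + a) [Suc 0..<Suc n] = [Suc a..<Suc (a + n)]" for n
    by (induction n) auto
  have "[1..<Suc (sum_list (a # k))] = 1 # [2..<Suc a] @ map (\<lambda>t. t + a) [1..<Suc (sum_list k)]"
    using \<open>0 < a\<close> upt_add_eq_append[of 1 "Suc a" "sum_list k"]
    by (simp add: * upt_conv_Cons add.commute numeral_2_eq_2 del: upt_Suc)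
  moreover define f where "f = (\<lambda>t. if t \<in> ?S (a # k) then E1 else E0)"
  moreover have "f 1 = E1" unfolding f_def S by simp
  moreover have "map f [2..<Suc a] = replicate (a - 1) E0"
    unfolding f_def S by (rule replicate_eqI) (auto simp del: upt_Suc)
  moreover have "map f (map (\<lambda>t. t + a) [1..<Suc (sum_list k)]) = index_word k"
  proof -
    have "map f (map (\<lambda>t. t + a) [1..<Suc (sum_list k)]) =
        map (\<lambda>t. if t \<in> ?S k then E1 else E0) [1..<Suc (sum_list k)]"
      unfolding f_def S using \<open>0 < a\<close> by (auto simp del: upt_Suc)
    also have "\<dots> = index_word k" using Cons.prems by (intro Cons.IH) simp
    finally show ?thesis .
  qed
  ultimately have "map f [1..<Suc (sum_list (a # k))] = E1 # replicate (a - 1) E0 @ index_word k"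
    by (simp only: list.map map_append)
  then show ?case unfolding f_def by (simp add: index_word_def)
qed

definition B_chain :: "nat \<Rightarrow> nat \<Rightarrow> node list" where
  "B_chain j n = map (NodeB j) [1..<Suc n]"

definition A_chain :: "nat \<Rightarrow> node list" where
  "A_chain n = map NodeA [1..<Suc n]"

text \<open>The final list joins the chain of the \<open>NodeA\<close> to that of the last entry
  \<open>m\<close>, whose bottom lies above \<open>NodeA (sum_list k)\<close>. With the chains
  listed by increasing \<open>j\<close>, consecutive ones carry the links from
  \<open>NodeB j 1\<close> to the top of chain \<open>j + 1\<close>.\<close>

definition Q_chains :: "nat list \<Rightarrow> nat list \<Rightarrow> nat \<Rightarrow> node list list" where
  "Q_chains k l m = map (\<lambda>i. B_chain (Suc i) (l ! i)) [0..<length l] @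
     [A_chain (sum_list k) @ B_chain (Suc (length l)) m]"

lemma B_chain_simps [simp]:
  "set (B_chain j n) = {NodeB j i | i. 1 \<le> i \<and> i \<le> n}"
  "chain_rel (B_chain j n) = {(NodeB j i, NodeB j (i + 1)) | i. 1 \<le> i \<and> i < n}"
  "distinct (B_chain j n)" "B_chain j n = [] \<longleftrightarrow> n = 0"
  "0 < n \<Longrightarrow> hd (B_chain j n) = NodeB j 1" "0 < n \<Longrightarrow> last (B_chain j n) = NodeB j n"
  unfolding B_chain_def chain_rel_map_upt
  by (auto simp: distinct_map inj_on_def hd_map last_map less_Suc_eq_le simp del: upt_Suc)

lemma A_chain_simps [simp]:
  "set (A_chain n) = {NodeA i | i. 1 \<le> i \<and> i \<le> n}"
  "chain_rel (A_chain n) = {(NodeA i, NodeA (i + 1)) | i. 1 \<le> i \<and> i < n}"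
  "distinct (A_chain n)" "A_chain n = [] \<longleftrightarrow> n = 0"
  "0 < n \<Longrightarrow> last (A_chain n) = NodeA n"
  unfolding A_chain_def chain_rel_map_upt
  by (auto simp: distinct_map inj_on_def last_map less_Suc_eq_le simp del: upt_Suc)

lemma sum_list_index_pos: "is_index k \<Longrightarrow> k \<noteq> [] \<Longrightarrow> 0 < sum_list k"
  by (cases k) auto

lemma nth_index_pos: "is_index l \<Longrightarrow> i < length l \<Longrightarrow> 0 < l ! i"
  by (simp add: is_index_def)

lemma set_concat_Q_chains: "set (concat (Q_chains k l m)) = Q_carrier k (l @ [m])"
proof -
  have "NodeB j i \<in> set (concat (Q_chains k l m)) \<longleftrightarrow> NodeB j i \<in> Q_carrier k (l @ [m])" for j i
    by (cases j) (auto simp: Q_chains_def Q_carrier_def nth_append less_Suc_eq)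
  moreover have "NodeA t \<in> set (concat (Q_chains k l m)) \<longleftrightarrow> NodeA t \<in> Q_carrier k (l @ [m])" for t
    by (auto simp: Q_chains_def Q_carrier_def)
  ultimately show ?thesis by (metis node.exhaust subsetI subset_antisym)
qed

lemma distinct_concat_Q_chains: "distinct (concat (Q_chains k l m))"
proof -
  have "distinct (concat (map (\<lambda>i. B_chain (Suc i) (l ! i)) [0..<n]))" for n
    by (induction n) auto
  then show ?thesis by (auto simp: Q_chains_def)
qed

lemma hd_last_Q_chains:
  assumes "is_index (l @ [m])"
  shows "i < length l \<Longrightarrow> hd (Q_chains k l m ! i) = NodeB (Suc i) 1"
    and "i \<le> length l \<Longrightarrow> last (Q_chains k l m ! i) = NodeB (Suc i) ((l @ [m]) ! i)"
  using assms nth_index_pos[of l i]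
  by (auto simp: Q_chains_def nth_append nth_append_right last_append)

lemma zigzag_gens_Q_chains:
  assumes "is_index k" "k \<noteq> []" "is_index (l @ [m])"
  shows "zigzag_gens (Q_chains k l m) = Q_generators k (l @ [m])"
proof -
  let ?cs = "Q_chains k l m" and ?l = "l @ [m]"
  have len: "length ?cs = Suc (length l)" by (simp add: Q_chains_def)
  have pos: "0 < sum_list k" "0 < m" using assms sum_list_index_pos by auto
  have "(\<lambda>(v, u). (hd v, last u)) ` set (zip ?cs (tl ?cs)) =
      (\<lambda>i. (hd (?cs ! i), last (?cs ! Suc i))) ` {..<length l}"
  proof -
    have "set (zip ?cs (tl ?cs)) = (\<lambda>i. (?cs ! i, ?cs ! Suc i)) ` {..<length l}"
      by (auto simp: set_zip nth_tl len image_iff)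
    then show ?thesis by (simp add: image_image)
  qed
  also have "\<dots> = (\<lambda>i. (NodeB (Suc i) 1, NodeB (Suc (Suc i)) (?l ! Suc i))) ` {..<length l}"
    using assms(3) by (intro image_cong) (auto simp: hd_last_Q_chains)
  also have "\<dots> = {(NodeB (j - 1) 1, NodeB j (?l ! (j - 1))) | j. 2 \<le> j \<and> j \<le> length ?l}"
    (is "?f ` _ = ?R")
  proof safe
    fix i assume "i < length l"
    then show "\<exists>j. ?f i = (NodeB (j - 1) 1, NodeB j (?l ! (j - 1))) \<and> 2 \<le> j \<and> j \<le> length ?l"
      by (intro exI[of _ "Suc (Suc i)"]) simp
  next
    fix j :: nat assume "2 \<le> j" "j \<le> length ?l"
    \<comment> \<open>Position \<open>i\<close> links chains \<open>i + 1\<close> and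
      \<open>i + 2\<close>, whence the witness \<open>j - 2\<close>.\<close>
    then show "(NodeB (j - 1) 1, NodeB j (?l ! (j - 1))) \<in> ?f ` {..<length l}"
      by (intro image_eqI[of _ _ "j - 2"]) (auto simp: Suc_diff_Suc numeral_2_eq_2)
  qed
  finally have links: "(\<lambda>(v, u). (hd v, last u)) ` set (zip ?cs (tl ?cs)) = ?R" .
  have chains: "(\<Union>c\<in>set ?cs. chain_rel c) =
      chain_rel (A_chain (sum_list k)) \<union> {(NodeA (sum_list k), NodeB (length ?l) 1)} \<union>
      ((\<Union>i<length l. chain_rel (B_chain (Suc i) (l ! i))) \<union> chain_rel (B_chain (Suc (length l)) m))"
  proof -
    have "A_chain (sum_list k) \<noteq> []" "B_chain (Suc (length l)) m \<noteq> []"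
      using pos A_chain_simps(4) by (metis less_irrefl, simp)
    note chain_rel_append[OF this]
    then have "chain_rel (A_chain (sum_list k) @ B_chain (Suc (length l)) m) =
        insert (NodeA (sum_list k), NodeB (Suc (length l)) 1)
          (chain_rel (A_chain (sum_list k)) \<union> chain_rel (B_chain (Suc (length l)) m))"
      by (simp only: A_chain_simps(5)[OF pos(1)] B_chain_simps(5)[OF pos(2)])
    then have "(\<Union>c\<in>set ?cs. chain_rel c) =
      (\<Union>i<length l. chain_rel (B_chain (Suc i) (l ! i))) \<union>
        insert (NodeA (sum_list k), NodeB (Suc (length l)) 1)
          (chain_rel (A_chain (sum_list k)) \<union> chain_rel (B_chain (Suc (length l)) m))"
      by (simp add: Q_chains_def lessThan_atLeast0 Un_commute del: B_chain_simps A_chain_simps)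
    then show ?thesis by (simp del: B_chain_simps A_chain_simps) blast
  qed
  have B: "(\<Union>i<length l. chain_rel (B_chain (Suc i) (l ! i))) \<union> chain_rel (B_chain (Suc (length l)) m)
      = {(NodeB j i, NodeB j (i + 1)) | j i. 1 \<le> j \<and> j \<le> length ?l \<and> 1 \<le> i \<and> i < ?l ! (j - 1)}"
    (is "?L = ?B")
  proof -
    have "?L = (\<Union>i<length ?l. chain_rel (B_chain (Suc i) (?l ! i)))"
      by (auto simp: lessThan_Suc nth_append)
    also have "\<dots> = ?B"
      by (auto simp: Bex_def) (metis Suc_le_lessD Suc_pred diff_Suc_1 less_Suc_eq_le)
    finally show ?thesis .
  qed
  show ?thesis
    unfolding zigzag_gens_def links chains B Q_generators_def A_chain_simps(2) ..
qed

lemma Nil_notin_Q_chains: "is_index (l @ [m]) \<Longrightarrow> [] \<notin> set (Q_chains k l m)"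
  using nth_index_pos[of l] by (force simp: Q_chains_def eq_commute[of "[]"])

lemma Q_generators_subset:
  assumes "is_index k" "k \<noteq> []" "is_index (l @ [m])"
  shows "Q_generators k (l @ [m]) \<subseteq> Q_carrier k (l @ [m]) \<times> Q_carrier k (l @ [m])"
proof -
  show ?thesis
    using Nil_notin_Q_chains[OF assms(3)] zigzag_gens_subset zigzag_gens_Q_chains[OF assms] set_concat_Q_chains by metis
qed

lemma mu_eq_poset_sum:
  assumes "is_index k" "k \<noteq> []" "is_index (l @ [m])"
  shows "mu k (l @ [m]) =
    poset_sum (Q_carrier k (l @ [m])) (Q_generators k (l @ [m])) (Q_label k (l @ [m]))"
  unfolding mu_def poset_sum_def Q_order_def
  by (simp only: linear_extensions_rtrancl[OF Q_generators_subset[OF assms]])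

lemma mu_eq_zigzag:
  assumes "is_index k" "k \<noteq> []" "is_index (l @ [m])"
  shows "mu k (l @ [m]) =
    zigzag (map (\<lambda>a. E1 # replicate (a - 1) E0) l @ [index_word k @ replicate m E0])"
proof -
  let ?d = "Q_label k (l @ [m])"
  note ne = Nil_notin_Q_chains[OF assms(3), of k]
  have "map ?d (B_chain (Suc i) (l ! i)) = E1 # replicate (l ! i - 1) E0" if "i < length l" for i
  proof -
    have "[1..<Suc (l ! i)] = 1 # [2..<Suc (l ! i)]"
      using nth_index_pos[of l i] assms(3) that
      by (simp add: upt_conv_Cons numeral_2_eq_2 del: upt_Suc)
    moreover have "map (\<lambda>t. ?d (NodeB (Suc i) t)) [2..<Suc (l ! i)] = replicate (l ! i - 1) E0"
      by (rule replicate_eqI) (auto simp del: upt_Suc)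
    ultimately show ?thesis using that by (simp add: B_chain_def o_def del: upt_Suc)
  qed
  then have "map (map ?d) (map (\<lambda>i. B_chain (Suc i) (l ! i)) [0..<length l]) =
      map (\<lambda>a. E1 # replicate (a - 1) E0) l"
    by (intro nth_equalityI) auto
  moreover have "map ?d (B_chain (Suc (length l)) m) = replicate m E0"
    unfolding B_chain_def by (rule replicate_eqI) (auto simp del: upt_Suc)
  moreover have "map ?d (A_chain (sum_list k)) = index_word k"
    using map_label_upt[OF assms(1)] by (simp add: A_chain_def o_def del: upt_Suc)
  ultimately have "map (map ?d) (Q_chains k l m) =
      map (\<lambda>a. E1 # replicate (a - 1) E0) l @ [index_word k @ replicate m E0]"
    by (simp add: Q_chains_def)
  then show ?thesis
    using poset_sum_zigzag[OF distinct_concat_Q_chains ne, where d = ?d]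
    by (simp only: mu_eq_poset_sum[OF assms] zigzag_gens_Q_chains[OF assms] set_concat_Q_chains)
qed

text \<open>The words of \<open>rev u\<close> stand in front of the joined chain, so
  \<open>alt_cuts_zigzag\<close> with no further chains fuses the word of \<open>l\<close> behind
  it.\<close>

lemma alt_cuts_mu:
  assumes "is_index (k @ [p])" "0 < m" "is_index l"
  shows "alt_cuts (\<lambda>u s. shuffle (mu (k @ [p]) (rev u @ [m])) (idx s)) l = idx (k @ [p + m] @ l)"
proof -
  let ?f = "\<lambda>a. E1 # replicate (a - 1) E0"
  have "alt_cuts (\<lambda>u s. shuffle (mu (k @ [p]) (rev u @ [m])) (idx s)) l =
      alt_cuts (\<lambda>u s. shuffle (zigzag (rev (map ?f u) @ [index_word (k @ [p]) @ replicate m E0]))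
        (word (concat (map ?f s)))) l"
    using assms
    by (intro alt_cuts_cong) (auto simp: mu_eq_zigzag rev_map idx_eq_word index_word_def)
  also have "\<dots> = word (index_word (k @ [p]) @ replicate m E0 @ index_word l)"
    by (simp add: alt_cuts_zigzag index_word_def)
  also have "index_word (k @ [p]) @ replicate m E0 @ index_word l = index_word (k @ [p + m] @ l)"
  proof -
    \<comment> \<open>The \<open>m\<close> letters \<open>E0\<close> lengthen the last block; since
      \<open>p\<close> is positive, the truncated subtraction is harmless.\<close>
    have "replicate (p - 1) E0 @ replicate m E0 = replicate (p + m - 1) E0"
      using assms(1) by (simp flip: replicate_add)
    then show ?thesis by (simp add: index_word_def)
  qed
  finally show ?thesis by (simp add: idx_eq_word)
qed

section \<open>Closure of the admissible part\<close>

lemma idx_span_sum: "(\<And>i. i \<in> A \<Longrightarrow> f i \<in> idx_span S) \<Longrightarrow> sum f A \<in> idx_span S"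
  by (induction A rule: infinite_finite_induct) auto

text \<open>The index is built from the left end of the word: a letter \<open>E1\<close> opens a new
  entry 1, a letter \<open>E0\<close> increases the last entry by 1.\<close>

lemma index_word_surj:
  assumes "w = [] \<or> hd w = E1"
  shows "\<exists>k. is_index k \<and> index_word k = w"
  using assms
proof (induction w rule: rev_induct)
  case Nil
  show ?case by (intro exI[of _ "[]"]) (simp add: index_word_def)
next
  case (snoc x w)
  then obtain k where k: "is_index k" "index_word k = w" by (cases w) auto
  show ?case
  proof (cases x)
    case E1
    then show ?thesis using k by (intro exI[of _ "k @ [1]"]) (simp add: index_word_def)
  next
    case E0
    then have "w \<noteq> []" using snoc.prems by auto
    then obtain k' a where "k = k' @ [a]"
      using k by (cases k rule: rev_cases) (auto simp: index_word_def)
    then have "index_word (k' @ [Suc a]) = w @ [E0]"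
      using k by (cases a) (auto simp: index_word_def simp flip: replicate_append_same)
    then show ?thesis using E0 k \<open>k = k' @ [a]\<close> by (intro exI[of _ "k' @ [Suc a]"]) simp
  qed
qed

lemma word_in_H0_span:
  assumes "w \<noteq> []" "hd w = E1" "last w = E0"
  shows "word w \<in> H0_span"
proof -
  obtain k where k: "is_index k" "index_word k = w" using index_word_surj assms by blast
  then obtain k' a where ka: "k = k' @ [a]"
    using assms(1) by (cases k rule: rev_cases) (auto simp: index_word_def)
  then have "a \<noteq> 1" using k(2) assms(3) by (auto simp: index_word_def)
  then have "admissible k" using k(1) ka by (auto simp: admissible_def)
  then show ?thesis using idx_in_idx_span[of k] k(2) by (simp add: idx_eq_word)
qed

lemma admissible_index_word:
  assumes "admissible k" "k \<noteq> []"
  shows "index_word k \<noteq> []" "hd (index_word k) = E1" "last (index_word k) = E0"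
proof -
  show "index_word k \<noteq> []" "hd (index_word k) = E1"
    using assms(2) by (cases k; simp add: index_word_def)+
  obtain k' a where "k = k' @ [a]" using assms(2) by (metis rev_exhaust)
  then show "last (index_word k) = E0"
    using assms(1) by (auto simp: index_word_def admissible_def last_append)
qed

section \<open>The shuffle product on the admissible part\<close>

lemma keys_shuffle_words: "Poly_Mapping.keys (shuffle_words u v) \<subseteq> shuffles u v"
proof (induction u v rule: shuffle_words.induct)
  case (3 a v b w)
  have *: "Poly_Mapping.keys (word [c] * x) \<subseteq> (#) c ` Poly_Mapping.keys x" for c x
    using keys_mult[of "word [c]" x] by (auto simp: word_def plus_list_def)
  have "Poly_Mapping.keys (shuffle_words (a # v) (b # w)) \<subseteq>
      Poly_Mapping.keys (word [a] * shuffle_words v (b # w)) \<union>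
      Poly_Mapping.keys (word [b] * shuffle_words (a # v) w)"
    using Poly_Mapping.keys_add by simp
  also have "\<dots> \<subseteq> shuffles (a # v) (b # w)"
    using order_trans[OF *[of a] image_mono[OF 3(1)]] order_trans[OF *[of b] image_mono[OF 3(2)]]
    by (simp only: shuffles.simps) blast
  finally show ?case .
qed (auto simp: word_def)

lemma last_shuffles:
  "zs \<in> shuffles xs ys \<Longrightarrow> xs \<noteq> [] \<Longrightarrow> ys \<noteq> [] \<Longrightarrow> last zs = last xs \<or> last zs = last ys"
proof (induction xs ys arbitrary: zs rule: shuffles.induct)
  case (3 x xs y ys)
  from 3(3) consider zs' where "zs = x # zs'" "zs' \<in> shuffles xs (y # ys)"
    | zs' where "zs = y # zs'" "zs' \<in> shuffles (x # xs) ys" by auto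
  then show ?case
  proof cases
    case 1
    then show ?thesis using 3(1)[OF 1(2)] by (cases "xs = []") auto
  next
    case 2
    then show ?thesis using 3(2)[OF 2(2)] by (cases "ys = []") auto
  qed
qed auto

lemma hd_shuffles:
  "zs \<in> shuffles xs ys \<Longrightarrow> xs \<noteq> [] \<Longrightarrow> ys \<noteq> [] \<Longrightarrow> zs \<noteq> [] \<and> (hd zs = hd xs \<or> hd zs = hd ys)"
  by (cases zs) (auto simp: Cons_in_shuffles_iff)

lemma shuffle_in_H0_span:
  assumes "x \<in> H0_span" "y \<in> H0_span" shows "shuffle x y \<in> H0_span"
  using _ assms
proof (rule shuffle.idx_span_closed)
  fix k l assume kl: "k \<in> {k. admissible k}" "l \<in> {k. admissible k}"
  show "shuffle (idx k) (idx l) \<in> H0_span"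
  proof (cases "k = [] \<or> l = []")
    case True
    then show ?thesis using kl by (auto simp: idx_Nil shuffle_1_left shuffle_1_right)
  next
    case False
    let ?u = "index_word k" and ?v = "index_word l"
    have uv: "?u \<noteq> []" "hd ?u = E1" "last ?u = E0" "?v \<noteq> []" "hd ?v = E1" "last ?v = E0"
      using False kl admissible_index_word by simp_all
    have "shuffle_words ?u ?v \<in> H0_span"
    \<comment> \<open>Every word in the support is a shuffle of two words that start with
      \<open>E1\<close> and end with \<open>E0\<close>, and inherits its ends from them.\<close>
    proof (rule hoff_induct[of "\<lambda>x. x \<in> H0_span"], goal_cases zero add scaled_word)
      case (scaled_word c w)
      then have "w \<in> shuffles ?u ?v" using keys_shuffle_words by blast
      then have "w \<noteq> []" "hd w = E1" "last w = E0"
        using hd_shuffles[of w ?u ?v] last_shuffles[of w ?u ?v] uv by auto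
      then show ?case by (intro idx_span_scaled word_in_H0_span)
    qed auto
    then show ?thesis by (simp add: idx_eq_word shuffle_word)
  qed
qed

section \<open>Membership of \<open>mu\<close> in the admissible part\<close>

lemma linear_extensions_hd_last:
  assumes "xs \<in> linear_extensions X R" "y \<in> X"
  shows "(y, hd xs) \<in> R \<Longrightarrow> y = hd xs" "(last xs, y) \<in> R \<Longrightarrow> y = last xs"
proof -
  have order: "i \<le> j" if "i < length xs" "j < length xs" "(xs ! i, xs ! j) \<in> R" for i j
    using assms(1) that by (simp add: linear_extensions_def)
  have "y \<in> set xs" using assms by (simp add: linear_extensions_def)
  then obtain i where i: "i < length xs" "xs ! i = y" by (metis in_set_conv_nth)
  then have ne: "xs \<noteq> []" by auto
  then have hl: "hd xs = xs ! 0" "last xs = xs ! (length xs - 1)" "0 < length xs"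
    by (simp_all add: hd_conv_nth last_conv_nth)
  show "y = hd xs" if "(y, hd xs) \<in> R"
  proof -
    have "i \<le> 0" using order[of i 0] that i hl by simp
    then show ?thesis using i hl by simp
  qed
  show "y = last xs" if "(last xs, y) \<in> R"
  proof -
    have "length xs - 1 \<le> i"
      using order[of "length xs - 1" i] that i hl by simp
    then have "i = length xs - 1" using i by simp
    then show ?thesis using i hl by simp
  qed
qed

text \<open>A linear extension starts at a minimal and ends at a maximal element. A minimal element
  is \<open>NodeA 1\<close> or some \<open>NodeB j 1\<close> with \<open>j < length l\<close>, both
  labelled \<open>E1\<close>. No \<open>NodeA\<close> is maximal, and neither is
  \<open>NodeB j 1\<close> with \<open>j < length l\<close>, which lies below the top of chain
  \<open>j + 1\<close>.\<close>

lemma mu_in_H0_span: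
  assumes "is_index k" "k \<noteq> []" "is_index l" "l \<noteq> []"
  shows "mu k l \<in> H0_span"
proof -
  obtain l' m where lm: "l = l' @ [m]" using assms(4) by (metis rev_exhaust)
  let ?X = "Q_carrier k l" and ?R = "Q_generators k l" and ?d = "Q_label k l"
  have R: "?R \<subseteq> ?X \<times> ?X" using Q_generators_subset assms lm by simp
  have pos: "0 < sum_list k" "\<And>j. 1 \<le> j \<Longrightarrow> j \<le> length l \<Longrightarrow> 0 < l ! (j - 1)"
    using assms sum_list_index_pos nth_index_pos[OF assms(3)] by auto
  have "word (map ?d xs) \<in> H0_span" if xs: "xs \<in> linear_extensions ?X ?R" for xs
  proof (rule word_in_H0_span)
    have X: "set xs = ?X" using xs by (simp add: linear_extensions_def)
    have "NodeA 1 \<in> ?X" using pos(1) by (auto simp: Q_carrier_def)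
    then have ne: "xs \<noteq> []" using X by auto
    then show "map ?d xs \<noteq> []" by simp
    have min: "y = hd xs" if "(y, hd xs) \<in> ?R" for y
      using linear_extensions_hd_last(1)[OF xs] that R by blast
    have max: "y = last xs" if "(last xs, y) \<in> ?R" for y
      using linear_extensions_hd_last(2)[OF xs] that R by blast
    have "?d (hd xs) = E1"
    proof (cases "hd xs")
      case (NodeA t)
      have "t = 1"
      proof (rule ccontr)
        assume "t \<noteq> 1"
        moreover have "NodeA t \<in> ?X" using NodeA ne X hd_in_set by metis
        ultimately have "(NodeA (t - 1), NodeA t) \<in> ?R"
          by (auto simp: Q_generators_def Q_carrier_def intro!: exI[of _ "t - 1"])
        then show False using min NodeA \<open>NodeA t \<in> ?X\<close> by (force simp: Q_carrier_def)
      qed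
      then show ?thesis using NodeA assms(2) by (auto intro!: exI[of _ 0])
    next
      case (NodeB j i)
      have B: "NodeB j i \<in> ?X" using NodeB ne X hd_in_set by metis
      have "i = 1"
      proof (rule ccontr)
        assume "i \<noteq> 1"
        then have "(NodeB j (i - 1), NodeB j i) \<in> ?R"
          using B by (auto simp: Q_generators_def Q_carrier_def intro!: exI[of _ "i - 1"])
        then show False using min NodeB B by (force simp: Q_carrier_def)
      qed
      moreover have "j < length l"
      proof (rule ccontr)
        assume "\<not> j < length l"
        then have "(NodeA (sum_list k), NodeB j i) \<in> ?R"
          using B \<open>i = 1\<close> by (auto simp: Q_generators_def Q_carrier_def)
        then show False using min NodeB by force
      qed
      ultimately show ?thesis using NodeB by simp
    qed
    then show "hd (map ?d xs) = E1" using ne by (simp add: hd_map)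
    have "?d (last xs) = E0"
    proof (cases "last xs")
      case (NodeA t)
      have B: "NodeA t \<in> ?X" using NodeA ne X last_in_set by metis
      then have "(NodeA t, NodeA (t + 1)) \<in> ?R \<or> (NodeA t, NodeB (length l) 1) \<in> ?R"
        by (auto simp: Q_generators_def Q_carrier_def)
      then show ?thesis using max NodeA by force
    next
      case (NodeB j i)
      have B: "NodeB j i \<in> ?X" using NodeB ne X last_in_set by metis
      have "\<not> (i = 1 \<and> j < length l)"
      proof
        assume *: "i = 1 \<and> j < length l"
        then have "(NodeB j i, NodeB (j + 1) (l ! j)) \<in> ?R"
          using B by (auto simp: Q_generators_def Q_carrier_def intro!: exI[of _ "j + 1"])
        then show False using max NodeB by force
      qed
      then show ?thesis using NodeB by auto
    qed
    then show "last (map ?d xs) = E0" using ne by (simp add: last_map)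
  qed
  then show ?thesis
    using assms lm by (simp add: mu_eq_poset_sum) (simp add: poset_sum_def idx_span_sum)
qed

section \<open>The harmonic product and \<open>circledast\<close> on the admissible part\<close>

lemma H1_span_mult_ek:
  assumes "x \<in> H1_span" "2 \<le> q" shows "x * ek q \<in> H0_span"
  using assms(1)
proof (rule idx_span_map[where T = "\<lambda>x. x * ek q"])
  fix k :: "nat list" assume "k \<in> {k. is_index k}"
  then have "admissible (k @ [q])" using assms(2) by (simp add: admissible_def)
  then show "idx k * ek q \<in> H0_span"
    using idx_in_idx_span[of "k @ [q]"] by (simp add: idx_append idx_single)
qed (simp_all add: distrib_right mult.assoc)

lemma H0_span_subset_H1_span: "H0_span \<subseteq> H1_span"
proof
  fix x assume "x \<in> H0_span"
  then show "x \<in> H1_span"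
    by induction (auto intro!: idx_span_scaled simp: admissible_def)
qed

lemma harmonic_in_H0_span:
  assumes "x \<in> H0_span" "y \<in> H0_span" shows "harmonic x y \<in> H0_span"
  using _ assms
proof (rule harmonic.idx_span_closed)
  fix k l assume kl: "k \<in> {k. admissible k}" "l \<in> {k. admissible k}"
  then have ix: "is_index k" "is_index l" by (auto simp: admissible_def)
  show "harmonic (idx k) (idx l) \<in> H0_span"
  proof (cases "k = [] \<or> l = []")
    case True
    then show ?thesis using kl ix by (auto simp: idx_Nil)
  next
    case False
    then obtain k' p l' q where "k = k' @ [p]" "l = l' @ [q]" by (metis rev_exhaust)
    moreover from this have "2 \<le> p" "2 \<le> q" using kl by (auto simp: admissible_def)
    \<comment> \<open>Every term ends in \<open>p\<close>, \<open>q\<close> or \<open>p + q\<close>,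
      each at least 2.\<close>
    ultimately show ?thesis
      using ix
      by (auto simp: harmonic_idx harmonic_indices_snoc
          intro!: H1_span_mult_ek harmonic_indices_in_H1_span idx_span.add)
  qed
qed

lemma star_glue_in_H0_span:
  "x \<in> H1_span \<Longrightarrow> 2 \<le> q \<Longrightarrow> is_index l \<Longrightarrow> star_glue x q l \<in> H0_span"
  by (induction x q l rule: star_glue.induct) (auto intro!: H1_span_mult_ek idx_span.add)

lemma circledast_in_H0_span:
  assumes "is_index k" "k \<noteq> []" "is_index l" "l \<noteq> []"
  shows "circledast (idx k) (star l) \<in> H0_span"
proof -
  obtain k' p l' m where "k = k' @ [p]" "l = l' @ [m]" using assms by (metis rev_exhaust)
  then show ?thesis
    using assms circledast_star[of k' p m "rev l'"] by (simp add: star_glue_in_H0_span)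
qed

lemma H0_span_subset_H0: "H0_span \<subseteq> H0"
proof
  fix x assume "x \<in> H0_span"
  then show "x \<in> H0"
  proof induction
    case zero
    show ?case unfolding H0_def by (auto intro!: exI[of _ 0])
  next
    case (add x y)
    then obtain c h c' h' where "x = const c + e1 * h * e0" "y = const c' + e1 * h' * e0"
      unfolding H0_def by blast
    then have "x + y = const (c + c') + e1 * (h + h') * e0"
      by (simp add: const_add algebra_simps)
    then show ?case unfolding H0_def by blast
  next
    case (scaled_idx k c)
    show ?case
    proof (cases "k = []")
      case True
      then have "const c * idx k = const c + e1 * 0 * e0" by (simp add: idx_Nil)
      then show ?thesis unfolding H0_def by blast
    next
      case False
      let ?w = "index_word k"
      note w = admissible_index_word[OF _ False]
      have "?w \<noteq> []" "hd ?w = E1" "last ?w = E0" using w scaled_idx by auto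
      then obtain v where "?w = [E1] @ v @ [E0]"
        by (cases ?w; cases "tl ?w" rule: rev_cases) auto
      then have "const c * idx k = const 0 + e1 * (const c * word v) * e0"
        by (simp add: idx_eq_word e1_def e0_def const_left_commute[of "word [E1]"] mult.assoc word_mult)
      then show ?thesis unfolding H0_def by blast
    qed
  qed
qed

section \<open>Transfer of multiplicativity\<close>

text \<open>This collects what the shuffle product with \<open>mu\<close> and the harmonic product
  with \<open>circledast\<close> have in common, so that the transfer is proved once and serves both
  directions.\<close>

locale telescoping_product = bilinear_hoff b for b +
  fixes A :: "nat list \<Rightarrow> nat list \<Rightarrow> hoff"
  assumes closed: "x \<in> H0_span \<Longrightarrow> y \<in> H0_span \<Longrightarrow> b x y \<in> H0_span"
    and one_left: "x \<in> H0_span \<Longrightarrow> b 1 x = x"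
    and one_right: "x \<in> H0_span \<Longrightarrow> b x 1 = x"
    and A_closed: "is_index k \<Longrightarrow> k \<noteq> [] \<Longrightarrow> is_index l \<Longrightarrow> l \<noteq> [] \<Longrightarrow> A k l \<in> H0_span"
    and telescope: "is_index (k @ [p]) \<Longrightarrow> 0 < m \<Longrightarrow> is_index l \<Longrightarrow>
      alt_cuts (\<lambda>u s. b (A (k @ [p]) (rev u @ [m])) (idx s)) l = idx (k @ [p + m] @ l)"

interpretation shuffle_mu: telescoping_product shuffle mu
  by standard
    (simp_all add: shuffle_in_H0_span shuffle_1_left shuffle_1_right mu_in_H0_span alt_cuts_mu
      del: append_Cons)

interpretation harmonic_circledast: telescoping_product harmonic "\<lambda>k l. circledast (idx k) (star l)"
  by standard
    (use H0_span_subset_H1_span in \<open>auto simp: harmonic_in_H0_span circledast_in_H0_span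
      alt_cuts_circledast subset_iff simp del: append_Cons\<close>)

definition multiplicative :: "(hoff \<Rightarrow> real) \<Rightarrow> (hoff \<Rightarrow> hoff \<Rightarrow> hoff) \<Rightarrow> bool" where
  "multiplicative Z b \<longleftrightarrow> (\<forall>k l. admissible k \<longrightarrow> admissible l \<longrightarrow>
     Z (b (idx k) (idx l)) = Z (idx k) * Z (idx l))"

lemma rat_linear_on_H0_span:
  assumes "rat_linear_on H0 Z"
  shows "x \<in> H0_span \<Longrightarrow> y \<in> H0_span \<Longrightarrow> Z (x + y) = Z x + Z y"
    and "x \<in> H0_span \<Longrightarrow> Z (const c * x) = of_rat c * Z x"
    and "x \<in> H0_span \<Longrightarrow> y \<in> H0_span \<Longrightarrow> Z (x - y) = Z x - Z y"
    and "Z 0 = 0"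
proof -
  show add: "Z (x + y) = Z x + Z y" if "x \<in> H0_span" "y \<in> H0_span" for x y
    using assms that H0_span_subset_H0 unfolding rat_linear_on_def by blast
  show "Z (const c * x) = of_rat c * Z x" if "x \<in> H0_span"
    using assms that H0_span_subset_H0 unfolding rat_linear_on_def by blast
  show "Z (x - y) = Z x - Z y" if "x \<in> H0_span" "y \<in> H0_span"
    using add[of "x - y" y] that by simp
  show "Z 0 = 0" using add[of 0 0] by simp
qed

text \<open>The values of \<open>A\<close> are linear combinations of admissible indices, which
  forces the extension in the first argument. The second stays one fixed index, as an induction on
  \<open>l\<close> provides it.\<close>

lemma (in telescoping_product) mult_span_left:
  assumes Z: "rat_linear_on H0 Z" and l: "admissible l" and "x \<in> H0_span"
    and mult: "\<And>k. admissible k \<Longrightarrow> Z (b (idx k) (idx l)) = Z (idx k) * Z (idx l)"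
  shows "Z (b x (idx l)) = Z x * Z (idx l)"
  using assms(3)
proof induction
  case zero
  then show ?case by (simp add: rat_linear_on_H0_span[OF Z])
next
  case (add x y)
  then show ?case
    using l by (simp add: add_left rat_linear_on_H0_span[OF Z] closed distrib_right)
next
  case (scaled_idx k c)
  then show ?case
    using l mult[of k] by (simp add: scaled_left rat_linear_on_H0_span[OF Z] closed)
qed

lemma admissible_append: "admissible (p @ s) \<Longrightarrow> admissible s"
  by (cases "s = []") (simp_all add: admissible_def)

lemma multiplicative_transfer:
  assumes "telescoping_product b A" "telescoping_product b' A'"
    and Z: "rat_linear_on H0 Z"
    and ZA: "\<And>k l. is_index k \<Longrightarrow> is_index l \<Longrightarrow> k \<noteq> [] \<Longrightarrow> l \<noteq> [] \<Longrightarrow> Z (A k l) = Z (A' k l)"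
    and mult: "multiplicative Z b"
  shows "multiplicative Z b'"
proof -
  interpret b: telescoping_product b A by fact
  interpret b': telescoping_product b' A' by fact
  note Z' = rat_linear_on_H0_span[OF Z]
  \<comment> \<open>Multiplicativity with the empty index replaces \<open>Z 1 = 1\<close>, which
    fails when \<open>Z\<close> vanishes.\<close>
  have Z_one: "Z 1 * Z (idx l) = Z (idx l)" if "admissible l" for l
    using mult[unfolded multiplicative_def, rule_format, of "[]" l] that
    by (simp add: b.one_left idx_Nil admissible_def)
  have "Z (b' (idx k) (idx l)) = Z (idx k) * Z (idx l)" if "admissible k" "admissible l" for k l
    using that
  proof (induction "length l" arbitrary: k l rule: less_induct)
    case less
    show ?case
    proof (cases "k = []")
      case True
      then show ?thesis using less.prems Z_one by (simp add: idx_Nil b'.one_left)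
    next
      case False
      then obtain k' a where k: "k = k' @ [a]" by (metis rev_exhaust)
      \<comment> \<open>As \<open>k\<close> is admissible, \<open>a\<close> is at least 2, so
        \<open>p\<close> is positive; the telescoping identities with \<open>m = 1\<close> restore
        the entry \<open>a\<close>.\<close>
      define p where "p = a - 1"
      have ix: "is_index (k' @ [p])" "p + 1 = a" "is_index l"
        using less.prems k by (auto simp: admissible_def p_def)
      let ?x = "\<lambda>u. A (k' @ [p]) (rev u @ [1])" and ?x' = "\<lambda>u. A' (k' @ [p]) (rev u @ [1])"
      have xs: "?x u \<in> H0_span" "?x' u \<in> H0_span" "Z (?x u) = Z (?x' u)" if "is_index u" for u
        using ix that by (auto intro!: b.A_closed b'.A_closed ZA)
      have cut: "is_index u" "admissible s" if "u @ s = l" for u s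
        using that less.prems ix admissible_append by auto
      have "alt_cuts (\<lambda>u s. Z (b (?x u) (idx s))) l = Z (idx (k' @ [p + 1] @ l))"
        using b.telescope[OF ix(1) _ ix(3), of 1] cut xs Z'(3)
        by (subst alt_cuts_map_on(2)[where V = H0_span]) (auto intro!: b.closed)
      moreover have "alt_cuts (\<lambda>u s. Z (b' (?x' u) (idx s))) l = Z (idx (k' @ [p + 1] @ l))"
        using b'.telescope[OF ix(1) _ ix(3), of 1] cut xs Z'(3)
        by (subst alt_cuts_map_on(2)[where V = H0_span]) (auto intro!: b'.closed)
      \<comment> \<open>Multiplicativity for \<open>b\<close> splits each term, and the values of
        \<open>A\<close> and \<open>A'\<close> agree under \<open>Z\<close>; the result speaks of
        \<open>A'\<close> only and can be compared with the sum for \<open>b'\<close>.\<close>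
      moreover have "alt_cuts (\<lambda>u s. Z (b (?x u) (idx s))) l =
          alt_cuts (\<lambda>u s. Z (?x' u) * Z (idx s)) l"
        using mult cut xs by (intro alt_cuts_cong) (auto simp: b.mult_span_left[OF Z] multiplicative_def)
      ultimately have "alt_cuts (\<lambda>u s. Z (b' (?x' u) (idx s))) l =
          alt_cuts (\<lambda>u s. Z (?x' u) * Z (idx s)) l" by simp
      then have "Z (b' (?x' []) (idx l)) = Z (?x' []) * Z (idx l)"
      proof (rule alt_cuts_eq_head)
        \<comment> \<open>A non-empty prefix leaves a shorter suffix, to which the induction
          hypothesis applies.\<close>
        fix u s assume us: "u @ s = l" "u \<noteq> []"
        then have "length s < length l" by auto
        note cut[OF us(1)]
        show "Z (b' (?x' u) (idx s)) = Z (?x' u) * Z (idx s)"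
          using Z \<open>admissible s\<close> xs(2)[OF \<open>is_index u\<close>]
            less.hyps[OF \<open>length s < length l\<close> _ \<open>admissible s\<close>]
          by (rule b'.mult_span_left)
      qed
      \<comment> \<open>The telescoping identity for the empty list has a single cut and so
        evaluates \<open>A'\<close>.\<close>
      moreover have "?x' [] = idx k"
        using b'.telescope[OF ix(1), of 1 "[]"] xs(2)[of "[]"] ix(2) k
        by (simp add: idx_Nil b'.one_right)
      ultimately show ?thesis by simp
    qed
  qed
  then show ?thesis by (simp add: multiplicative_def)
qed

theorem theorem4p8:
  fixes Z :: "hoff \<Rightarrow> real"
  assumes "rat_linear_on H0 Z"
    and "\<And>k l. is_index k \<Longrightarrow> is_index l \<Longrightarrow> k \<noteq> [] \<Longrightarrow> l \<noteq> [] \<Longrightarrow>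
           Z (mu k l) = Z (circledast (idx k) (star l))"
  shows "(\<forall>k l. admissible k \<longrightarrow> admissible l \<longrightarrow>
            Z (shuffle (idx k) (idx l)) = Z (idx k) * Z (idx l)) \<longleftrightarrow>
         (\<forall>k l. admissible k \<longrightarrow> admissible l \<longrightarrow>
            Z (harmonic (idx k) (idx l)) = Z (idx k) * Z (idx l))"
  unfolding multiplicative_def[symmetric]
proof
  show "multiplicative Z harmonic" if "multiplicative Z shuffle"
    using shuffle_mu.telescoping_product_axioms harmonic_circledast.telescoping_product_axioms
      assms that by (rule multiplicative_transfer)
  show "multiplicative Z shuffle" if "multiplicative Z harmonic"
    using harmonic_circledast.telescoping_product_axioms shuffle_mu.telescoping_product_axioms
      assms(1) assms(2)[symmetric] that by (rule multiplicative_transfer)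
qed

end
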